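(* Let the regularization parameter $\alpha=\alpha(h,\delta)\in\mathbb{R}$, $h,\delta>0$, satisfy $$\delta-\alpha(h,\delta)\le \inf_{B\in\mathcal{M}_0(T)}\inf\sigma(T_h(B))\quad\text{for all } h,\delta>0,\qquad\text{and}\qquad \lim_{h,\delta\to0}\alpha(h,\delta)=0.$$ Then the set-theoretic limit of $\mathcal{M}_{\alpha(h,\delta)}(T_h^\delta)$ as $h,\delta\to0$ exists and $$\lim_{h,\delta\to0}\mathcal{M}_{\alpha(h,\delta)}(T_h^\delta)=\mathcal{M}_0(T)=\bigcap_{h,\delta>0}\mathcal{M}_{\alpha(h,\delta)}(T_h^\delta).$$
   Context: Let $\Omega\subset\mathbb{R}^n$, $n\in\{2,3\}$, be a bounded domain with Lipschitz boundary $\partial\Omega$ and outward unit normal $\nu$. All functions are real-valued. Put $L^\infty_+(\Omega)=\{w\in L^\infty(\Omega):\operatorname{ess\,inf}w>0\}$, $L^2_\diamond(\partial\Omega)=\{w\in L^2(\partial\Omega):\int_{\partial\Omega}w\,dS=0\}$ and $H^1_\diamond(\Omega)=\{w\in H^1(\Omega):\int_{\partial\Omega}w|_{\partial\Omega}\,dS=0\}$. For $\gamma\in L^\infty_+(\Omega)$ the Neumann-to-Dirichlet map $\Lambda(\gamma):L^2_\diamond(\partial\Omega)\to L^2_\diamond(\partial\Omega)$ is $f\mapsto u|_{\partial\Omega}$, where $u\in H^1_\diamond(\Omega)$ is the unique weak solution of $\nabla\cdot(\gamma\nabla u)=0$ in $\Omega$, $\nu\cdot\gamma\nabla u=f$ on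 $\partial\Omega$. It is compact and self-adjoint. Approximate models: $\{\Lambda_h(\gamma)\}_{h>0}$ is a family of compact self-adjoint operators on $L^2_\diamond(\partial\Omega)$, given for every $\gamma\in L^\infty_+(\Omega)$, such that $\|\Lambda(\gamma)-\Lambda_h(\gamma)\|_{\mathcal{L}(L^2_\diamond(\partial\Omega))}\le\omega(h)\|\gamma\|_{L^\infty(\Omega)}$ for all $\gamma\in L^\infty_+(\Omega)$, where $\omega$ does not depend on $\gamma$ and $\lim_{h\to0}\omega(h)=0$. Noise: $\{N^\delta\}_{\delta>0}$ is a family of compact self-adjoint operators on $L^2_\diamond(\partial\Omega)$ with $\|N^\delta\|_{\mathcal{L}(L^2_\diamond(\partial\Omega))}\le\delta$, and $\Lambda_h^\delta(\gamma)=\Lambda_h(\gamma)+N^\delta$. Fix the conductivity $\gamma=\gamma_0+\kappa\chi_D$, where $\gamma_0\in C^\infty(\overline\Omega)\cap L^\infty_+(\Omega)$, $\kappa\in L^\infty_+(\Omega)$, $D$ is open with $\overline D\subseteq\Omega$, and $\chi_D$ is the characteristic function of $D$. Fix a constant $\beta>0$. For open $B\subseteq\Omega$ let $T(B)=\Lambda(\gamma_0+\beta\chi_B)-\Lambda(\gamma)$, $\;T_h(B)=\Lambda_h(\gamma_0+\beta\chi_B)-\Lambda_h(\gamma)$, $\;T_h^\delta(B)=\Lambda_h(\gamma_0+\beta\chi_B)-\Lambda_h^\delta(\gamma)$. For $S\in\{T,T_h^\delta\}$ and $\alpha\in\mathbb{R}$ let $\mathcal{M}_\alpha(S)=\{B\subseteq\Omega\text{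 open ball}: S(B)+\alpha\,\mathrm{Id}\ge0\}$, where $\ge0$ is meant in the sense of positive semidefiniteness. $\sigma(\cdot)$ denotes the spectrum. Set-theoretic limit: for a family of sets $\{A_{h,\delta}\}_{h,\delta>0}$, the limit $\lim_{h,\delta\to0}A_{h,\delta}$ exists if $\bigcup_{\varepsilon>0}\bigcap_{h,\delta\in(0,\varepsilon]}A_{h,\delta}$ and $\bigcap_{\varepsilon>0}\bigcup_{h,\delta\in(0,\varepsilon]}A_{h,\delta}$ coincide, and the limit is then their common value. *)

theory Defs
  imports "HOL-Analysis.Analysis" "HOL-Probability.Essential_Supremum"
begin

section \<open>Surface measure\<close>

text \<open>
  The $d$-dimensional Hausdorff measure, normalised to agree with Lebesgue measure in
  dimension $d$. The covering sets must be required to be bounded because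
  \<^const>\<open>diameter\<close> is unspecified on unbounded sets. The definition is meant for $d > 0$.
\<close>

definition hausdorff_weight :: "nat \<Rightarrow> 'a::metric_space set \<Rightarrow> ennreal" where
  "hausdorff_weight d U = ennreal (unit_ball_vol (real d) * (diameter U / 2) ^ d)"

definition hausdorff_covers :: "real \<Rightarrow> 'a::metric_space set \<Rightarrow> (nat \<Rightarrow> 'a set) set" where
  "hausdorff_covers \<epsilon> A =
     {U. (\<forall>i. bounded (U i) \<and> diameter (U i) \<le> \<epsilon>) \<and> A \<subseteq> (\<Union>i. U i)}"

definition hausdorff_pre :: "nat \<Rightarrow> real \<Rightarrow> 'a::metric_space set \<Rightarrow> ennreal" where
  "hausdorff_pre d \<epsilon> A = (INF U\<in>hausdorff_covers \<epsilon> A. \<Sum>i. hausdorff_weight d (U i))"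

definition hausdorff_outer :: "nat \<Rightarrow> 'a::metric_space set \<Rightarrow> ennreal" where
  "hausdorff_outer d A = (SUP \<epsilon>\<in>{0<..}. hausdorff_pre d \<epsilon> A)"

definition hausdorff_measure :: "nat \<Rightarrow> 'a::metric_space measure" where
  "hausdorff_measure d = measure_of UNIV (sets borel) (hausdorff_outer d)"

lemma hausdorff_weight_empty: "0 < d \<Longrightarrow> hausdorff_weight d {} = 0"
  by (simp add: hausdorff_weight_def zero_power)

lemma hausdorff_outer_empty:
  assumes "0 < d" shows "hausdorff_outer d {} = 0"
proof -
  have "hausdorff_pre d \<epsilon> ({}::'a set) = 0" if "0 < \<epsilon>" for \<epsilon>
  proof -
    have "hausdorff_pre d \<epsilon> ({}::'a set) \<le> (\<Sum>i. hausdorff_weight d ((\<lambda>_. {}) (i::nat) :: 'a set))"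
      unfolding hausdorff_pre_def by (rule INF_lower) (use that in \<open>auto simp: hausdorff_covers_def\<close>)
    also have "\<dots> = 0" using assms by (simp add: hausdorff_weight_empty)
    finally show ?thesis by simp
  qed
  then show ?thesis unfolding hausdorff_outer_def
    by (intro antisym SUP_least) auto
qed

lemma hausdorff_pre_mono: "A \<subseteq> B \<Longrightarrow> hausdorff_pre d \<epsilon> A \<le> hausdorff_pre d \<epsilon> B"
  unfolding hausdorff_pre_def by (rule INF_superset_mono) (auto simp: hausdorff_covers_def)

lemma hausdorff_pre_antimono: "\<epsilon> \<le> \<epsilon>' \<Longrightarrow> hausdorff_pre d \<epsilon>' A \<le> hausdorff_pre d \<epsilon> A"
  unfolding hausdorff_pre_def
  by (rule INF_superset_mono) (auto simp: hausdorff_covers_def intro: order_trans)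

lemma hausdorff_outer_mono: "A \<subseteq> B \<Longrightarrow> hausdorff_outer d A \<le> hausdorff_outer d B"
  unfolding hausdorff_outer_def by (intro SUP_mono) (use hausdorff_pre_mono in blast)

lemma hausdorff_pre_le_outer: "0 < \<epsilon> \<Longrightarrow> hausdorff_pre d \<epsilon> A \<le> hausdorff_outer d A"
  unfolding hausdorff_outer_def by (rule SUP_upper) auto

lemma hausdorff_pre_countably_subadditive:
  "hausdorff_pre d \<epsilon> (\<Union>n. A n) \<le> (\<Sum>n. hausdorff_pre d \<epsilon> (A n :: 'a::metric_space set))"
proof (rule ennreal_le_epsilon)
  fix e :: real
  assume fin: "(\<Sum>n. hausdorff_pre d \<epsilon> (A n)) < top" and e: "0 < e"
  have "\<exists>U\<in>hausdorff_covers \<epsilon> (A n). (\<Sum>i. hausdorff_weight d (U i))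
      \<le> hausdorff_pre d \<epsilon> (A n) + ennreal (e * (1/2) ^ Suc n)" for n
  proof -
    have "hausdorff_pre d \<epsilon> (A n) \<le> (\<Sum>n. hausdorff_pre d \<epsilon> (A n))"
      using sum_le_suminf[of "\<lambda>n. hausdorff_pre d \<epsilon> (A n)" "{n}"] by simp
    then have ft: "hausdorff_pre d \<epsilon> (A n) < top" using fin by (rule le_less_trans)
    have "hausdorff_pre d \<epsilon> (A n) < hausdorff_pre d \<epsilon> (A n) + ennreal (e * (1/2) ^ Suc n)"
      using ft e by (metis ennreal_add_left_cancel_less add.right_neutral ennreal_less_zero_iff
          infinity_ennreal_def less_irrefl mult_pos_pos zero_less_power half_gt_zero_iff zero_less_one)
    then have "(INF U\<in>hausdorff_covers \<epsilon> (A n). \<Sum>i. hausdorff_weight d (U i))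
        < hausdorff_pre d \<epsilon> (A n) + ennreal (e * (1/2) ^ Suc n)"
      unfolding hausdorff_pre_def[symmetric] .
    then show ?thesis unfolding INF_less_iff by (auto intro: less_imp_le)
  qed
  then obtain U where U: "\<And>n. U n \<in> hausdorff_covers \<epsilon> (A n)"
    and Us: "\<And>n. (\<Sum>i. hausdorff_weight d (U n i))
      \<le> hausdorff_pre d \<epsilon> (A n) + ennreal (e * (1/2) ^ Suc n)"
    by metis
  define V where "V k = (case prod_decode k of (n, i) \<Rightarrow> U n i)" for k
  have V: "V \<in> hausdorff_covers \<epsilon> (\<Union>n. A n)"
  proof -
    have "\<exists>k. x \<in> V k" if "x \<in> A n" for x n
    proof -
      from that U[of n] obtain i where "x \<in> U n i" by (auto simp: hausdorff_covers_def)
      then have "x \<in> V (prod_encode (n, i))" by (simp add: V_def)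
      then show ?thesis ..
    qed
    moreover have "bounded (V k) \<and> diameter (V k) \<le> \<epsilon>" for k
      using U by (auto simp: V_def hausdorff_covers_def split: prod.split)
    ultimately show ?thesis by (auto simp: hausdorff_covers_def)
  qed
  have "hausdorff_pre d \<epsilon> (\<Union>n. A n) \<le> (\<Sum>k. hausdorff_weight d (V k))"
    unfolding hausdorff_pre_def by (rule INF_lower[OF V])
  also have "\<dots> = (\<Sum>k. (\<lambda>(n, i). hausdorff_weight d (U n i)) (prod_decode k))"
    by (simp add: V_def case_prod_beta)
  also have "\<dots> = (\<Sum>n. \<Sum>i. hausdorff_weight d (U n i))"
    by (rule suminf_ennreal_2dimen) simp
  also have "\<dots> \<le> (\<Sum>n. hausdorff_pre d \<epsilon> (A n) + ennreal (e * (1/2) ^ Suc n))"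
    by (intro suminf_le Us summableI)
  also have "\<dots> = (\<Sum>n. hausdorff_pre d \<epsilon> (A n)) + (\<Sum>n. ennreal (e * (1/2) ^ Suc n))"
    by (rule suminf_add[symmetric]) auto
  also have "(\<Sum>n. ennreal (e * (1/2) ^ Suc n)) = ennreal (\<Sum>n. e * (1/2) ^ Suc n)"
    using e by (intro suminf_ennreal2) (auto intro!: summable_mult summable_geometric)
  also have "(\<Sum>n. e * (1/2) ^ Suc n) = e"
    using sums_mult[OF power_half_series, of e] by (simp add: sums_iff)
  finally show "hausdorff_pre d \<epsilon> (\<Union>n. A n) \<le> (\<Sum>n. hausdorff_pre d \<epsilon> (A n)) + ennreal e" .
qed

lemma hausdorff_outer_countably_subadditive:
  "hausdorff_outer d (\<Union>n. A n) \<le> (\<Sum>n. hausdorff_outer d (A n :: 'a::metric_space set))"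
proof -
  have "hausdorff_pre d \<epsilon> (\<Union>n. A n) \<le> (\<Sum>n. hausdorff_outer d (A n))" if "0 < \<epsilon>" for \<epsilon>
    using hausdorff_pre_countably_subadditive
    by (rule order_trans) (intro suminf_le summableI hausdorff_pre_le_outer that)
  then show ?thesis
    unfolding hausdorff_outer_def[of d "\<Union>n. A n"] by (intro SUP_least) auto
qed

lemma hausdorff_outer_Un:
  assumes "0 < d"
  shows "hausdorff_outer d (A \<union> B) \<le> hausdorff_outer d A + hausdorff_outer d (B :: 'a::metric_space set)"
proof -
  define C where "C n = (if n = (0::nat) then A else if n = 1 then B else {})" for n
  have "A \<union> B = (\<Union>n. C n)"
    by (force simp: C_def split: if_splits)
  then have "hausdorff_outer d (A \<union> B) \<le> (\<Sum>n. hausdorff_outer d (C n))"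
    by (metis hausdorff_outer_countably_subadditive)
  also have "\<dots> = (\<Sum>n\<in>{0,1}. hausdorff_outer d (C n))"
    by (rule suminf_finite) (auto simp: C_def hausdorff_outer_empty[OF assms])
  finally show ?thesis by (simp add: C_def)
qed

lemma hausdorff_outer_separated:
  fixes A B :: "'a::metric_space set"
  assumes r: "0 < r" and sep: "\<And>x y. x \<in> A \<Longrightarrow> y \<in> B \<Longrightarrow> r \<le> dist x y" and d: "0 < d"
  shows "hausdorff_outer d A + hausdorff_outer d B \<le> hausdorff_outer d (A \<union> B)"
proof -
  have key: "hausdorff_pre d \<epsilon> A + hausdorff_pre d \<epsilon> B \<le> hausdorff_pre d \<epsilon> (A \<union> B)"
    if \<epsilon>: "0 < \<epsilon>" "\<epsilon> < r" for \<epsilon>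
    unfolding hausdorff_pre_def[of d \<epsilon> "A \<union> B"]
  proof (rule INF_greatest)
    fix U assume U: "U \<in> hausdorff_covers \<epsilon> (A \<union> B)"
    define V where "V i = (if U i \<inter> A \<noteq> {} then U i else {})" for i
    define W where "W i = (if U i \<inter> B \<noteq> {} then U i else {})" for i
    have disj: "V i = {} \<or> W i = {}" for i
    proof (rule ccontr)
      assume "\<not> ?thesis"
      then obtain x y where "x \<in> U i" "x \<in> A" "y \<in> U i" "y \<in> B"
        by (auto simp: V_def W_def split: if_splits)
      then have "dist x y \<le> diameter (U i)" "r \<le> dist x y"
        using U sep by (auto simp: hausdorff_covers_def intro!: diameter_bounded_bound)
      moreover have "diameter (U i) \<le> \<epsilon>" using U by (auto simp: hausdorff_covers_def)
      ultimately show False using \<epsilon> by simp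
    qed
    have VW: "V \<in> hausdorff_covers \<epsilon> A" "W \<in> hausdorff_covers \<epsilon> B"
      using U \<epsilon> by (force simp: hausdorff_covers_def V_def W_def)+
    have w: "hausdorff_weight d (V i) + hausdorff_weight d (W i) \<le> hausdorff_weight d (U i)" for i
    proof -
      have "V i = {} \<and> (W i = U i \<or> W i = {}) \<or> W i = {} \<and> (V i = U i \<or> V i = {})"
        using disj[of i] unfolding V_def W_def by presburger
      then show ?thesis using hausdorff_weight_empty[OF d] by auto
    qed
    have "hausdorff_pre d \<epsilon> A + hausdorff_pre d \<epsilon> B
        \<le> (\<Sum>i. hausdorff_weight d (V i)) + (\<Sum>i. hausdorff_weight d (W i))"
      unfolding hausdorff_pre_def by (intro add_mono INF_lower VW)
    also have "\<dots> = (\<Sum>i. hausdorff_weight d (V i) + hausdorff_weight d (W i))"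
      by (rule suminf_add) auto
    also have "\<dots> \<le> (\<Sum>i. hausdorff_weight d (U i))"
      by (intro suminf_le w summableI)
    finally show "hausdorff_pre d \<epsilon> A + hausdorff_pre d \<epsilon> B \<le> (\<Sum>i. hausdorff_weight d (U i))" .
  qed
  have bound: "hausdorff_pre d \<epsilon> A + hausdorff_pre d \<epsilon>' B \<le> hausdorff_outer d (A \<union> B)"
    if "0 < \<epsilon>" "0 < \<epsilon>'" for \<epsilon> \<epsilon>'
  proof -
    define \<eta> where "\<eta> = min (min \<epsilon> \<epsilon>') (r / 2)"
    have \<eta>: "0 < \<eta>" "\<eta> < r" "\<eta> \<le> \<epsilon>" "\<eta> \<le> \<epsilon>'" using that r by (auto simp: \<eta>_def)
    have "hausdorff_pre d \<epsilon> A + hausdorff_pre d \<epsilon>' B \<le> hausdorff_pre d \<eta> A + hausdorff_pre d \<eta> B"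
      by (intro add_mono hausdorff_pre_antimono \<eta>)
    also have "\<dots> \<le> hausdorff_pre d \<eta> (A \<union> B)" by (rule key) (use \<eta> in auto)
    also have "\<dots> \<le> hausdorff_outer d (A \<union> B)" by (rule hausdorff_pre_le_outer) (use \<eta> in auto)
    finally show ?thesis .
  qed
  have ne: "{0<..} \<noteq> ({}::real set)" by (metis greaterThan_iff empty_iff zero_less_one)
  have "hausdorff_pre d \<epsilon> A + hausdorff_outer d B \<le> hausdorff_outer d (A \<union> B)" if "0 < \<epsilon>" for \<epsilon>
    unfolding hausdorff_outer_def[of d B]
    by (subst ennreal_SUP_add_right[OF ne]) (auto intro!: SUP_least bound that)
  then have "hausdorff_outer d B + hausdorff_outer d A \<le> hausdorff_outer d (A \<union> B)"
    unfolding hausdorff_outer_def[of d A]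
    by (subst ennreal_SUP_add_right[OF ne]) (auto intro!: SUP_least simp: add.commute)
  then show ?thesis by (simp add: add.commute)
qed

lemma hausdorff_outer_closed:
  fixes C A :: "'a::metric_space set"
  assumes C: "closed C" and d: "0 < d"
  shows "hausdorff_outer d (A \<inter> C) + hausdorff_outer d (A - C) \<le> hausdorff_outer d A"
proof (cases "hausdorff_outer d A = top \<or> C = {}")
  case True
  then show ?thesis by (auto simp: hausdorff_outer_empty[OF d])
next
  case False
  then have fin: "hausdorff_outer d A < top" and Cne: "C \<noteq> {}" by (auto simp: less_top)
  define H where "H = (hausdorff_outer d :: 'a set \<Rightarrow> ennreal)"
  define t where "t n = 1 / (real n + 1)" for n
  define E where "E n = {x \<in> A. t n \<le> infdist x C}" for n
  define R where "R n = E (Suc n) - E n" for n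
  have tpos: "0 < t n" for n by (simp add: t_def)
  have tdec: "t n < t m" if "m < n" for m n
    using that by (simp add: t_def field_simps)
  have sepC: "r \<le> dist x y" if "r \<le> infdist x C" "y \<in> C" for x y r
    using infdist_le[OF that(2), of x] that(1) by simp
  have E_C: "H (A \<inter> C) + H (E n) \<le> H A" for n
  proof -
    have "H (E n) + H (A \<inter> C) \<le> H (E n \<union> (A \<inter> C))"
      unfolding H_def
      by (rule hausdorff_outer_separated[OF tpos[of n] _ d]) (auto simp: E_def intro: sepC)
    also have "\<dots> \<le> H A"
      unfolding H_def by (rule hausdorff_outer_mono) (auto simp: E_def)
    finally show ?thesis by (simp add: add.commute)
  qed
  have Rsep: "t (Suc m) - t n \<le> dist x y" if "x \<in> R m" "y \<in> R n" "m < n" for m n x y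
  proof -
    have "t (Suc m) \<le> infdist x C" using that by (auto simp: R_def E_def)
    moreover have "infdist y C \<le> t n" using that by (auto simp: R_def E_def)
    moreover have "infdist x C \<le> infdist y C + dist x y"
      by (rule infdist_triangle)
    ultimately show ?thesis by simp
  qed
  have alt: "(\<Sum>k<n. H (R (2 * k + c))) \<le> H (\<Union>k<n. R (2 * k + c))" for n c
  proof (induction n)
    case 0 then show ?case by simp
  next
    case (Suc n)
    have "(\<Sum>k<Suc n. H (R (2 * k + c))) \<le> H (\<Union>k<n. R (2 * k + c)) + H (R (2 * n + c))"
      using Suc by (simp add: add_mono)
    also have "\<dots> \<le> H (\<Union>k<Suc n. R (2 * k + c))"
    proof (cases "n = 0")
      case True
      then show ?thesis unfolding True by (simp add: H_def hausdorff_outer_empty[OF d] lessThan_Suc)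
    next
      case False
      have "H (\<Union>k<n. R (2 * k + c)) + H (R (2 * n + c))
          \<le> H ((\<Union>k<n. R (2 * k + c)) \<union> R (2 * n + c))"
        unfolding H_def
      proof (rule hausdorff_outer_separated[OF _ _ d])
        show "0 < t (2 * n + c - 1) - t (2 * n + c)"
          using tdec[of "2 * n + c - 1" "2 * n + c"] False by simp
        fix x y assume "x \<in> (\<Union>k<n. R (2 * k + c))" and y: "y \<in> R (2 * n + c)"
        then obtain k where k: "k < n" "x \<in> R (2 * k + c)" by auto
        have "t (2 * n + c - 1) \<le> t (Suc (2 * k + c))"
        proof -
          have "Suc (2 * k + c) \<le> 2 * n + c - 1" using k(1) by linarith
          then show ?thesis
            using tdec[of "Suc (2 * k + c)" "2 * n + c - 1"] by (auto simp: order.order_iff_strict)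
        qed
        with Rsep[OF k(2) y] k show "t (2 * n + c - 1) - t (2 * n + c) \<le> dist x y" by simp
      qed
      also have "(\<Union>k<n. R (2 * k + c)) \<union> R (2 * n + c) = (\<Union>k<Suc n. R (2 * k + c))"
        by (auto simp: lessThan_Suc)
      finally show ?thesis .
    qed
    finally show ?case .
  qed
  have sumR: "(\<Sum>k<n. H (R k)) \<le> H A + H A" for n
  proof -
    have "(\<Sum>k<n. H (R k)) \<le> (\<Sum>k<2 * n. H (R k))"
      by (rule sum_mono2) auto
    also have "\<dots> = (\<Sum>k<n. H (R (2 * k))) + (\<Sum>k<n. H (R (2 * k + 1)))"
      by (induction n) (auto simp: algebra_simps)
    also have "\<dots> \<le> H A + H A"
    proof (rule add_mono)
      have "(\<Sum>k<n. H (R (2 * k + 0))) \<le> H A"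
        by (rule order_trans[OF alt])
          (auto simp: H_def R_def E_def intro!: hausdorff_outer_mono)
      then show "(\<Sum>k<n. H (R (2 * k))) \<le> H A" by simp
      show "(\<Sum>k<n. H (R (2 * k + 1))) \<le> H A"
        by (rule order_trans[OF alt])
          (auto simp: H_def R_def E_def intro!: hausdorff_outer_mono)
    qed
    finally show ?thesis .
  qed
  have "(\<Sum>k. H (R k)) \<le> H A + H A"
    by (rule suminf_le_const) (auto intro: sumR)
  then have finR: "(\<Sum>k. H (R k)) \<noteq> top"
    using fin by (auto simp: H_def top_unique)
  have dec: "H (A - C) \<le> H (E n) + (\<Sum>k. H (R (k + n)))" for n
  proof -
    have "A - C \<subseteq> E n \<union> (\<Union>k. R (k + n))"
    proof
      fix x assume x: "x \<in> A - C"
      then have "0 < infdist x C"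
        using C Cne by (simp add: infdist_pos_not_in_closed)
      then obtain m where m: "inverse (real (Suc m)) < infdist x C"
        using reals_Archimedean by blast
      then have xm: "x \<in> E m" using x by (auto simp: E_def t_def inverse_eq_divide add.commute)
      define p where "p = (LEAST p. x \<in> E p)"
      have p: "x \<in> E p" unfolding p_def by (rule LeastI[of "\<lambda>p. x \<in> E p", OF xm])
      have pl: "x \<notin> E q" if "q < p" for q
        using that not_less_Least unfolding p_def by blast
      show "x \<in> E n \<union> (\<Union>k. R (k + n))"
      proof (cases "p \<le> n")
        case True
        then have "t n \<le> t p" using tdec[of p n] by (cases "p = n") auto
        with p show ?thesis by (auto simp: E_def)
      next
        case False
        then obtain k where k: "p = Suc (k + n)"
          by (metis add.commute add_Suc less_imp_Suc_add not_le)
        then have "x \<in> R (k + n)" using p pl[of "k + n"] by (auto simp: R_def)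
        then show ?thesis by auto
      qed
    qed
    then have "H (A - C) \<le> H (E n \<union> (\<Union>k. R (k + n)))"
      unfolding H_def by (rule hausdorff_outer_mono)
    also have "\<dots> \<le> H (E n) + H (\<Union>k. R (k + n))"
      unfolding H_def by (rule hausdorff_outer_Un[OF d])
    also have "H (\<Union>k. R (k + n)) \<le> (\<Sum>k. H (R (k + n)))"
      unfolding H_def by (rule hausdorff_outer_countably_subadditive)
    finally show ?thesis by (simp add: add_left_mono)
  qed
  have tail: "(\<lambda>n. \<Sum>k. H (R (k + n))) \<longlonglongrightarrow> 0"
  proof -
    have fk: "H (R k) \<noteq> top" for k
      using finR sum_le_suminf[of "\<lambda>k. H (R k)" "{k}"] by (auto simp: top_unique)
    define r where "r k = enn2real (H (R k))" for k
    have r: "H (R k) = ennreal (r k)" "0 \<le> r k" for k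
      using fk[of k] by (auto simp: r_def less_top)
    have sr: "summable r"
      using finR r by (intro summable_suminf_not_top) auto
    have "(\<lambda>n. ennreal (\<Sum>k. r (k + n))) \<longlonglongrightarrow> ennreal 0"
      by (intro tendsto_ennrealI suminf_exist_split2 sr)
    moreover have "(\<Sum>k. H (R (k + n))) = ennreal (\<Sum>k. r (k + n))" for n
      unfolding r(1) using sr r(2) by (intro suminf_ennreal2) (auto simp: summable_iff_shift)
    ultimately show ?thesis by simp
  qed
  have "H (A \<inter> C) + H (A - C) \<le> H A + (\<Sum>k. H (R (k + n)))" for n
  proof -
    have "H (A \<inter> C) + H (A - C) \<le> H (A \<inter> C) + (H (E n) + (\<Sum>k. H (R (k + n))))"
      by (intro add_left_mono dec)
    also have "\<dots> = (H (A \<inter> C) + H (E n)) + (\<Sum>k. H (R (k + n)))" by (simp add: add.assoc)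
    also have "\<dots> \<le> H A + (\<Sum>k. H (R (k + n)))" by (intro add_right_mono E_C)
    finally show ?thesis .
  qed
  moreover have "(\<lambda>n. H A + (\<Sum>k. H (R (k + n)))) \<longlonglongrightarrow> H A + 0"
    by (intro tendsto_add tendsto_const tail)
  ultimately have "H (A \<inter> C) + H (A - C) \<le> H A + 0"
    by (intro LIMSEQ_le_const) auto
  then show ?thesis by (simp add: H_def)
qed

theorem
  assumes "0 < d"
  shows measure_space_hausdorff: "measure_space UNIV (sets borel) (hausdorff_outer d :: 'a::metric_space set \<Rightarrow> ennreal)"
    and emeasure_hausdorff: "A \<in> sets borel \<Longrightarrow> emeasure (hausdorff_measure d) A = hausdorff_outer d (A :: 'a set)"
proof -
  interpret P: sigma_algebra UNIV "UNIV :: 'a set set"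
    using sigma_algebra_Pow[of UNIV] by simp
  let ?H = "hausdorff_outer d :: 'a set \<Rightarrow> ennreal"
  let ?L = "lambda_system UNIV UNIV ?H"
  have "outer_measure_space UNIV ?H"
    unfolding outer_measure_space_def positive_def increasing_def countably_subadditive_def
    by (auto simp: hausdorff_outer_empty[OF assms] hausdorff_outer_mono
        hausdorff_outer_countably_subadditive)
  then have L: "measure_space UNIV ?L ?H" by (rule P.caratheodory_lemma)
  have "C \<in> ?L" if "closed C" for C
    unfolding P.lambda_system_eq
  proof (simp, intro allI antisym)
    fix A
    show "?H (A \<inter> C) + ?H (A - C) \<le> ?H A"
      by (rule hausdorff_outer_closed[OF that assms])
    show "?H A \<le> ?H (A \<inter> C) + ?H (A - C)"
      using hausdorff_outer_Un[OF assms, of "A \<inter> C" "A - C"] by (simp add: Int_Diff_Un)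
  qed
  then have "sigma_sets UNIV {C :: 'a set. closed C} \<subseteq> ?L"
    using L by (intro sigma_algebra.sigma_sets_subset) (auto simp: measure_space_def)
  then have "sets (borel :: 'a measure) \<subseteq> ?L"
    by (simp add: borel_eq_closed)
  then show M: "measure_space UNIV (sets borel) ?H"
    by (rule measure_down[OF L, rotated]) (metis sets.sigma_algebra_axioms space_borel)
  show "emeasure (hausdorff_measure d) A = ?H A" if "A \<in> sets borel"
    using M that unfolding hausdorff_measure_def measure_space_def
    by (intro emeasure_measure_of_sigma) auto
qed


definition surface_measure :: "(real^'n) set \<Rightarrow> (real^'n) measure" where
  "surface_measure \<Omega> = restrict_space (hausdorff_measure (CARD('n) - 1)) (frontier \<Omega>)"


section \<open>Domains\<close>

text \<open>
  Near each boundary point, $\Omega$ is the strict epigraph of a Lipschitz function $\varphi$ in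
  a rotated coordinate system: \<open>e\<close> is the vertical direction and $y - (y\cdot e) e$ is the
  horizontal part of $y$.
\<close>

definition lipschitz_boundary :: "(real^'n) set \<Rightarrow> bool" where
  "lipschitz_boundary \<Omega> \<longleftrightarrow>
     (\<forall>x\<in>frontier \<Omega>. \<exists>r>0. \<exists>e \<phi> L. norm e = 1 \<and> L-lipschitz_on {z. z \<bullet> e = 0} \<phi> \<and>
        (\<forall>y\<in>ball x r. y \<in> \<Omega> \<longleftrightarrow> \<phi> (y - (y \<bullet> e) *\<^sub>R e) < y \<bullet> e))"

definition lipschitz_domain :: "(real^'n) set \<Rightarrow> bool" where
  "lipschitz_domain \<Omega> \<longleftrightarrow>
     open \<Omega> \<and> connected \<Omega> \<and> \<Omega> \<noteq> {} \<and> bounded \<Omega> \<and> lipschitz_boundary \<Omega>"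


section \<open>Function spaces\<close>

text \<open>
  Elements of Lebesgue spaces are represented by functions; functions that agree almost
  everywhere represent the same element.
\<close>

definition L2 :: "'a measure \<Rightarrow> ('a \<Rightarrow> 'b::euclidean_space) set" where
  "L2 M = {f \<in> borel_measurable M. integrable M (\<lambda>x. (norm (f x))\<^sup>2)}"

definition L2norm :: "'a measure \<Rightarrow> ('a \<Rightarrow> 'b::euclidean_space) \<Rightarrow> real" where
  "L2norm M f = sqrt (\<integral>x. (norm (f x))\<^sup>2 \<partial>M)"

definition L2inner :: "'a measure \<Rightarrow> ('a \<Rightarrow> real) \<Rightarrow> ('a \<Rightarrow> real) \<Rightarrow> real" where
  "L2inner M f g = (\<integral>x. f x * g x \<partial>M)"

text \<open>
  Mean-free functions. \<^const>\<open>has_bochner_integral\<close> is used because \<^const>\<open>lebesgue_integral\<close>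
  is \<open>0\<close> on non-integrable functions.
\<close>

definition L2_diamond :: "'a measure \<Rightarrow> ('a \<Rightarrow> real) set" where
  "L2_diamond M = {f \<in> L2 M. has_bochner_integral M f 0}"

definition Linf_norm :: "(real^'n) set \<Rightarrow> (real^'n \<Rightarrow> real) \<Rightarrow> ereal" where
  "Linf_norm \<Omega> f = esssup (lebesgue_on \<Omega>) (\<lambda>x. ereal \<bar>f x\<bar>)"

definition essinf :: "'a measure \<Rightarrow> ('a \<Rightarrow> ereal) \<Rightarrow> ereal" where
  "essinf M f = - esssup M (\<lambda>x. - f x)"

definition Linf_plus :: "(real^'n) set \<Rightarrow> (real^'n \<Rightarrow> real) set" where
  "Linf_plus \<Omega> = {f \<in> borel_measurable (lebesgue_on \<Omega>).
     Linf_norm \<Omega> f < \<infinity> \<and> 0 < essinf (lebesgue_on \<Omega>) (\<lambda>x. ereal (f x))}"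

text \<open>
  $C^k(\overline S)$ for open \<open>S\<close>: all partial derivatives of order at most $k$ exist in \<open>S\<close> and
  extend continuously to the closure of \<open>S\<close>. For \<open>S = UNIV\<close> this is the usual $C^k$.
\<close>

definition extends_to_closure :: "'a::euclidean_space set \<Rightarrow> ('a \<Rightarrow> real) \<Rightarrow> bool" where
  "extends_to_closure S f \<longleftrightarrow> (\<exists>F. continuous_on (closure S) F \<and> (\<forall>x\<in>S. F x = f x))"

primrec Ck_closure :: "nat \<Rightarrow> 'a::euclidean_space set \<Rightarrow> ('a \<Rightarrow> real) \<Rightarrow> bool" where
  "Ck_closure 0 S f \<longleftrightarrow> extends_to_closure S f"
| "Ck_closure (Suc k) S f \<longleftrightarrow> extends_to_closure S f \<and>
     (\<exists>g. (\<forall>x\<in>S. GDERIV f x :> g x) \<and> (\<forall>b\<in>Basis. Ck_closure k S (\<lambda>x. g x \<bullet> b)))"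

definition Cinf_closure :: "'a::euclidean_space set \<Rightarrow> ('a \<Rightarrow> real) \<Rightarrow> bool" where
  "Cinf_closure S f \<longleftrightarrow> (\<forall>k. Ck_closure k S f)"

definition test_function :: "(real^'n) set \<Rightarrow> (real^'n \<Rightarrow> real) \<Rightarrow> bool" where
  "test_function \<Omega> \<phi> \<longleftrightarrow>
     Cinf_closure UNIV \<phi> \<and> (\<exists>K. compact K \<and> K \<subseteq> \<Omega> \<and> (\<forall>x. x \<notin> K \<longrightarrow> \<phi> x = 0))"

definition has_weak_gradient ::
    "(real^'n) set \<Rightarrow> (real^'n \<Rightarrow> real) \<Rightarrow> (real^'n \<Rightarrow> real^'n) \<Rightarrow> bool" where
  "has_weak_gradient \<Omega> u g \<longleftrightarrow>
     (\<forall>\<phi> G. test_function \<Omega> \<phi> \<and> (\<forall>x. GDERIV \<phi> x :> G x) \<longrightarrow>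
        (\<integral>x. u x *\<^sub>R G x \<partial>lebesgue_on \<Omega>) = - (\<integral>x. \<phi> x *\<^sub>R g x \<partial>lebesgue_on \<Omega>))"

definition H1_with_gradient ::
    "(real^'n) set \<Rightarrow> (real^'n \<Rightarrow> real) \<Rightarrow> (real^'n \<Rightarrow> real^'n) \<Rightarrow> bool" where
  "H1_with_gradient \<Omega> u g \<longleftrightarrow>
     u \<in> L2 (lebesgue_on \<Omega>) \<and> g \<in> L2 (lebesgue_on \<Omega>) \<and> has_weak_gradient \<Omega> u g"

definition H1 :: "(real^'n) set \<Rightarrow> (real^'n \<Rightarrow> real) set" where
  "H1 \<Omega> = {u. \<exists>g. H1_with_gradient \<Omega> u g}"

text \<open>
  \<open>w\<close> represents the boundary trace of \<open>u\<close>: the $L^2(\partial\Omega)$-limit of the restrictions to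
  the boundary of smooth functions converging to \<open>u\<close> in $H^1(\Omega)$, that is, the value at \<open>u\<close> of
  the continuous extension of the restriction map.
\<close>

definition has_trace :: "(real^'n) set \<Rightarrow> (real^'n \<Rightarrow> real) \<Rightarrow> (real^'n \<Rightarrow> real) \<Rightarrow> bool" where
  "has_trace \<Omega> u w \<longleftrightarrow> w \<in> L2 (surface_measure \<Omega>) \<and>
     (\<exists>g \<phi> G. H1_with_gradient \<Omega> u g \<and>
        (\<forall>k::nat. Cinf_closure UNIV (\<phi> k) \<and> (\<forall>x. GDERIV (\<phi> k) x :> G k x)) \<and>
        (\<lambda>k. L2norm (lebesgue_on \<Omega>) (\<lambda>x. \<phi> k x - u x)) \<longlonglongrightarrow> 0 \<and>
        (\<lambda>k. L2norm (lebesgue_on \<Omega>) (\<lambda>x. G k x - g x)) \<longlonglongrightarrow> 0 \<and>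
        (\<lambda>k. L2norm (surface_measure \<Omega>) (\<lambda>x. \<phi> k x - w x)) \<longlonglongrightarrow> 0)"

definition H1_diamond :: "(real^'n) set \<Rightarrow> (real^'n \<Rightarrow> real) set" where
  "H1_diamond \<Omega> =
     {u \<in> H1 \<Omega>. \<exists>w. has_trace \<Omega> u w \<and> has_bochner_integral (surface_measure \<Omega>) w 0}"


section \<open>The Neumann-to-Dirichlet map\<close>

text \<open>
  $\int_\Omega \gamma \nabla u\cdot\nabla v\,dx = \int_{\partial\Omega} f v|_{\partial\Omega}\,dS$
  for all $v \in H^1(\Omega)$.
\<close>

definition weak_neumann_solution ::
    "(real^'n) set \<Rightarrow> (real^'n \<Rightarrow> real) \<Rightarrow> (real^'n \<Rightarrow> real) \<Rightarrow> (real^'n \<Rightarrow> real) \<Rightarrow> bool" where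
  "weak_neumann_solution \<Omega> \<gamma> f u \<longleftrightarrow>
     (\<exists>g. H1_with_gradient \<Omega> u g \<and>
        (\<forall>v h w. H1_with_gradient \<Omega> v h \<and> has_trace \<Omega> v w \<longrightarrow>
           (\<integral>x. \<gamma> x * (g x \<bullet> h x) \<partial>lebesgue_on \<Omega>) = (\<integral>x. f x * w x \<partial>surface_measure \<Omega>)))"

text \<open>The choice only fixes a representative of the trace in $L^2_\diamond(\partial\Omega)$.\<close>

definition ND_map :: "(real^'n) set \<Rightarrow> (real^'n \<Rightarrow> real) \<Rightarrow> (real^'n \<Rightarrow> real) \<Rightarrow> (real^'n \<Rightarrow> real)" where
  "ND_map \<Omega> \<gamma> f =
     (SOME w. \<exists>u\<in>H1_diamond \<Omega>. weak_neumann_solution \<Omega> \<gamma> f u \<and> has_trace \<Omega> u w)"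


section \<open>Operators on mean-free functions\<close>

text \<open>
  Operators act on representatives, and equations between values are almost everywhere.
  Linearity together with a norm bound makes an operator respect almost everywhere equality,
  so it descends to the Hilbert space $L^2_\diamond$ of equivalence classes.
\<close>

type_synonym 'a oper = "('a \<Rightarrow> real) \<Rightarrow> ('a \<Rightarrow> real)"

definition linear_oper :: "'a measure \<Rightarrow> 'a oper \<Rightarrow> bool" where
  "linear_oper M A \<longleftrightarrow>
     (\<forall>f\<in>L2_diamond M. A f \<in> L2_diamond M) \<and>
     (\<forall>f\<in>L2_diamond M. \<forall>g\<in>L2_diamond M. \<forall>a b.
        AE x in M. A (\<lambda>y. a * f y + b * g y) x = a * A f x + b * A g x)"

definition norm_bound :: "'a measure \<Rightarrow> 'a oper \<Rightarrow> real \<Rightarrow> bool" where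
  "norm_bound M A C \<longleftrightarrow> 0 \<le> C \<and> (\<forall>f\<in>L2_diamond M. L2norm M (A f) \<le> C * L2norm M f)"

definition bounded_oper :: "'a measure \<Rightarrow> 'a oper \<Rightarrow> bool" where
  "bounded_oper M A \<longleftrightarrow> linear_oper M A \<and> (\<exists>C. norm_bound M A C)"

text \<open>The operator norm; it is \<open>\<infinity>\<close> if \<open>A\<close> is not a bounded linear operator on $L^2_\diamond$.\<close>

definition oper_norm :: "'a measure \<Rightarrow> 'a oper \<Rightarrow> ereal" where
  "oper_norm M A = (INF C\<in>{C. linear_oper M A \<and> norm_bound M A C}. ereal C)"

definition compact_oper :: "'a measure \<Rightarrow> 'a oper \<Rightarrow> bool" where
  "compact_oper M A \<longleftrightarrow> bounded_oper M A \<and>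
     (\<forall>F. (\<forall>k::nat. F k \<in> L2_diamond M) \<and> (\<exists>C. \<forall>k. L2norm M (F k) \<le> C) \<longrightarrow>
        (\<exists>r g. strict_mono r \<and> g \<in> L2_diamond M \<and>
           (\<lambda>k. L2norm M (\<lambda>x. A (F (r k)) x - g x)) \<longlonglongrightarrow> 0))"

definition self_adjoint_oper :: "'a measure \<Rightarrow> 'a oper \<Rightarrow> bool" where
  "self_adjoint_oper M A \<longleftrightarrow>
     (\<forall>f\<in>L2_diamond M. \<forall>g\<in>L2_diamond M. L2inner M (A f) g = L2inner M f (A g))"

definition pos_semidef_oper :: "'a measure \<Rightarrow> 'a oper \<Rightarrow> bool" where
  "pos_semidef_oper M A \<longleftrightarrow> (\<forall>f\<in>L2_diamond M. 0 \<le> L2inner M (A f) f)"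

text \<open>Complement of the set of \<open>s\<close> for which $A - s\,\mathrm{Id}$ has a bounded inverse \<open>R\<close>.\<close>

definition oper_spectrum :: "'a measure \<Rightarrow> 'a oper \<Rightarrow> real set" where
  "oper_spectrum M A = {s. \<not> (\<exists>R. bounded_oper M R \<and>
     (\<forall>f\<in>L2_diamond M.
        (AE x in M. R (\<lambda>y. A f y - s * f y) x = f x) \<and>
        (AE x in M. A (R f) x - s * R f x = f x)))}"


section \<open>Ball tests\<close>

definition test_conductivity ::
    "(real^'n \<Rightarrow> real) \<Rightarrow> real \<Rightarrow> (real^'n) set \<Rightarrow> (real^'n \<Rightarrow> real)" where
  "test_conductivity \<gamma>0 \<beta> B = (\<lambda>x. \<gamma>0 x + \<beta> * indicator B x)"

definition ball_tests ::
    "(real^'n) set \<Rightarrow> real \<Rightarrow> ((real^'n) set \<Rightarrow> (real^'n) oper) \<Rightarrow> (real^'n) set set" where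
  "ball_tests \<Omega> \<alpha> S = {B. B \<subseteq> \<Omega> \<and> (\<exists>c r. 0 < r \<and> B = ball c r) \<and>
     pos_semidef_oper (surface_measure \<Omega>) (\<lambda>f x. S B f x + \<alpha> * f x)}"


section \<open>Set-theoretic limits\<close>

definition set_liminf :: "(real \<Rightarrow> real \<Rightarrow> 'a set) \<Rightarrow> 'a set" where
  "set_liminf A = (\<Union>\<epsilon>\<in>{0<..}. \<Inter>h\<in>{0<..\<epsilon>}. \<Inter>\<delta>\<in>{0<..\<epsilon>}. A h \<delta>)"

definition set_limsup :: "(real \<Rightarrow> real \<Rightarrow> 'a set) \<Rightarrow> 'a set" where
  "set_limsup A = (\<Inter>\<epsilon>\<in>{0<..}. \<Union>h\<in>{0<..\<epsilon>}. \<Union>\<delta>\<in>{0<..\<epsilon>}. A h \<delta>)"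

definition has_set_limit :: "(real \<Rightarrow> real \<Rightarrow> 'a set) \<Rightarrow> 'a set \<Rightarrow> bool" where
  "has_set_limit A L \<longleftrightarrow> set_liminf A = L \<and> set_limsup A = L"

end

theory Submission
  imports Defs
begin

text \<open>
  Only quadratic forms matter. For a bounded self-adjoint operator the infimum of the spectrum
  bounds the form from below, so the choice of $\alpha$ gives
  $\langle T_h(B) f, f\rangle \ge (\delta - \alpha)\|f\|^2$ for $B \in \mathcal{M}_0(T)$; subtracting the
  noise costs at most $\delta\|f\|^2$, hence $\mathcal{M}_0(T) \subseteq \mathcal{M}_\alpha(T_h^\delta)$.
  Conversely, if \<open>B\<close> passes the regularised test for arbitrarily small \<open>h\<close> and \<open>\<delta>\<close>, then
  $\langle T(B) f, f\rangle \ge -(\alpha + \delta + O(\omega(h)))\|f\|^2$, which tends to $0$.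
  The error bound itself makes $\Lambda(\gamma) - \Lambda_h(\gamma)$ a bounded linear operator, so
  $\Lambda(\gamma)$ need not be studied directly.
\<close>

section \<open>The space of mean-free square-integrable functions\<close>

lemma L2_diamondD:
  assumes "f \<in> L2_diamond M"
  shows "f \<in> borel_measurable M" "integrable M (\<lambda>x. (f x)\<^sup>2)" "has_bochner_integral M f 0"
  using assms by (auto simp: L2_diamond_def L2_def)

lemma integrable_mult_L2_diamond:
  assumes "f \<in> L2_diamond M" "g \<in> L2_diamond M"
  shows "integrable M (\<lambda>x. f x * g x)"
proof (rule Bochner_Integration.integrable_bound)
  show "integrable M (\<lambda>x. (f x)\<^sup>2 + (g x)\<^sup>2)"
    using assms by (intro Bochner_Integration.integrable_add L2_diamondD)
  show "(\<lambda>x. f x * g x) \<in> borel_measurable M"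
    using assms by (intro borel_measurable_times L2_diamondD)
  have "\<bar>a * b\<bar> \<le> a\<^sup>2 + b\<^sup>2" for a b :: real
  proof -
    have "2 * \<bar>a * b\<bar> \<le> a\<^sup>2 + b\<^sup>2"
      using sum_squares_bound[of "\<bar>a\<bar>" "\<bar>b\<bar>"] by (simp add: abs_mult)
    then show ?thesis by linarith
  qed
  then show "AE x in M. norm (f x * g x) \<le> norm ((f x)\<^sup>2 + (g x)\<^sup>2)"
    by auto
qed

lemma L2_diamond_lincomb:
  assumes f: "f \<in> L2_diamond M" and g: "g \<in> L2_diamond M"
  shows "(\<lambda>x. a * f x + b * g x) \<in> L2_diamond M"
proof -
  have "integrable M (\<lambda>x. a\<^sup>2 * (f x)\<^sup>2 + 2 * a * b * (f x * g x) + b\<^sup>2 * (g x)\<^sup>2)"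
    using L2_diamondD(2)[OF f] L2_diamondD(2)[OF g] integrable_mult_L2_diamond[OF f g]
    by (intro Bochner_Integration.integrable_add integrable_mult_right)
  also have "(\<lambda>x. a\<^sup>2 * (f x)\<^sup>2 + 2 * a * b * (f x * g x) + b\<^sup>2 * (g x)\<^sup>2)
      = (\<lambda>x. (norm (a * f x + b * g x))\<^sup>2)"
    by (auto simp: power2_eq_square algebra_simps)
  finally have "integrable M \<dots>" .
  moreover have "has_bochner_integral M (\<lambda>x. a * f x + b * g x) (a * 0 + b * 0)"
    using f g by (intro has_bochner_integral_add has_bochner_integral_mult_right L2_diamondD)
  moreover have "(\<lambda>x. a * f x + b * g x) \<in> borel_measurable M"
    using L2_diamondD(1)[OF f] L2_diamondD(1)[OF g] by measurable
  ultimately show ?thesis by (simp add: L2_diamond_def L2_def)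
qed

lemma L2_diamond_diff:
  assumes "f \<in> L2_diamond M" "g \<in> L2_diamond M"
  shows "(\<lambda>x. f x - g x) \<in> L2_diamond M"
  using L2_diamond_lincomb[OF assms, of 1 "-1"] by simp

section \<open>Inner product and norm on representatives, where norm zero only means zero almost
  everywhere\<close>

lemma L2inner_commute: "L2inner M f g = L2inner M g f"
  by (simp add: L2inner_def mult.commute)

lemma L2inner_lincomb_left:
  assumes "f \<in> L2_diamond M" "g \<in> L2_diamond M" "u \<in> L2_diamond M"
  shows "L2inner M (\<lambda>x. a * f x + b * g x) u = a * L2inner M f u + b * L2inner M g u"
proof -
  have "L2inner M (\<lambda>x. a * f x + b * g x) u = (\<integral>x. a * (f x * u x) + b * (g x * u x) \<partial>M)"
    unfolding L2inner_def by (intro arg_cong[where f = "integral\<^sup>L M"]) (auto simp: algebra_simps)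
  also have "\<dots> = (\<integral>x. a * (f x * u x) \<partial>M) + (\<integral>x. b * (g x * u x) \<partial>M)"
    using assms by (intro Bochner_Integration.integral_add integrable_mult_right integrable_mult_L2_diamond)
  finally show ?thesis by (simp add: L2inner_def)
qed

lemma L2inner_lincomb_right:
  assumes "f \<in> L2_diamond M" "g \<in> L2_diamond M" "u \<in> L2_diamond M"
  shows "L2inner M u (\<lambda>x. a * f x + b * g x) = a * L2inner M u f + b * L2inner M u g"
  using L2inner_lincomb_left[OF assms] by (simp add: L2inner_commute[of M u])

lemma L2inner_diff_left:
  assumes "f \<in> L2_diamond M" "g \<in> L2_diamond M" "u \<in> L2_diamond M"
  shows "L2inner M (\<lambda>x. f x - g x) u = L2inner M f u - L2inner M g u"
  using L2inner_lincomb_left[OF assms, of 1 "-1"] by simp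

lemma L2inner_cong_AE:
  assumes "f \<in> L2_diamond M" "g \<in> L2_diamond M" "u \<in> L2_diamond M" "AE x in M. f x = g x"
  shows "L2inner M f u = L2inner M g u"
  unfolding L2inner_def
  using assms(4) by (intro integral_cong_AE borel_measurable_times L2_diamondD assms) auto

lemma L2inner_self_nonneg: "0 \<le> L2inner M f f"
  unfolding L2inner_def by (rule integral_nonneg_AE) auto

lemma L2inner_self: "L2inner M f f = (L2norm M f)\<^sup>2"
  using L2inner_self_nonneg[of M f] by (simp add: L2inner_def L2norm_def power2_eq_square)

lemma L2norm_nonneg: "0 \<le> L2norm M f"
  unfolding L2norm_def by (rule real_sqrt_ge_zero) (rule integral_nonneg_AE, auto)

lemma L2norm_cong_AE:
  fixes f g :: "'a \<Rightarrow> real"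
  assumes "f \<in> L2_diamond M" "g \<in> L2_diamond M" "AE x in M. f x = g x"
  shows "L2norm M f = L2norm M g"
proof -
  have "(\<integral>x. (norm (f x))\<^sup>2 \<partial>M) = (\<integral>x. (norm (g x))\<^sup>2 \<partial>M)"
    using assms(3) L2_diamondD(1)[OF assms(1)] L2_diamondD(1)[OF assms(2)]
    by (intro integral_cong_AE) (measurable, auto)
  then show ?thesis by (simp add: L2norm_def)
qed

lemma L2inner_self_lincomb:
  assumes "f \<in> L2_diamond M" "g \<in> L2_diamond M"
  shows "L2inner M (\<lambda>x. a * f x + b * g x) (\<lambda>x. a * f x + b * g x)
    = a\<^sup>2 * L2inner M f f + 2 * a * b * L2inner M f g + b\<^sup>2 * L2inner M g g"
  using assms L2inner_commute[of M g f]
  by (simp add: L2inner_lincomb_left L2inner_lincomb_right L2_diamond_lincomb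
      power2_eq_square algebra_simps)

text \<open>The form at \<open>f - t g\<close> is a nonnegative quadratic in \<open>t\<close>. Since
  \<open>L2inner\<close> is only semidefinite on representatives, the degenerate case
  \<open>c = 0\<close> needs its own argument.\<close>

lemma L2inner_Cauchy_Schwarz:
  assumes f: "f \<in> L2_diamond M" and g: "g \<in> L2_diamond M"
  shows "\<bar>L2inner M f g\<bar> \<le> L2norm M f * L2norm M g"
proof -
  define a b c where "a = L2inner M f f" and "b = L2inner M f g" and "c = L2inner M g g"
  have q: "0 \<le> a - 2 * t * b + t\<^sup>2 * c" for t
    using L2inner_self_nonneg[of M "\<lambda>x. 1 * f x + (- t) * g x"]
    unfolding L2inner_self_lincomb[OF f g] by (simp add: a_def b_def c_def)
  have c: "0 \<le> c" unfolding c_def by (rule L2inner_self_nonneg)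
  have "b\<^sup>2 \<le> a * c"
  proof (cases "c = 0")
    case True
    have "b = 0"
    proof (rule ccontr)
      assume "b \<noteq> 0"
      \<comment> \<open>With \<open>c = 0\<close> the quadratic is affine in \<open>t\<close>, and
        at this point it takes the value -1.\<close>
      then show False using q[of "(a + 1) / (2 * b)"] True by simp
    qed
    then show ?thesis using True by simp
  next
    case False
    \<comment> \<open>The point \<open>b / c\<close> minimises the quadratic.\<close>
    then have "0 \<le> (a - 2 * (b / c) * b + (b / c)\<^sup>2 * c) * c"
      by (intro mult_nonneg_nonneg q c)
    also have "\<dots> = a * c - b\<^sup>2"
      using False by (simp add: field_simps power2_eq_square)
    finally show ?thesis by simp
  qed
  then have "\<bar>b\<bar>\<^sup>2 \<le> (L2norm M f * L2norm M g)\<^sup>2"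
    by (simp add: a_def c_def L2inner_self power_mult_distrib)
  then show ?thesis
    unfolding b_def by (rule power2_le_imp_le) (simp add: L2norm_nonneg)
qed

text \<open>Compare squares: Cauchy-Schwarz controls the cross term, and absolute values absorb the
  signs of \<open>a\<close> and \<open>b\<close>.\<close>

lemma L2norm_lincomb_le:
  fixes f g :: "'a \<Rightarrow> real"
  assumes f: "f \<in> L2_diamond M" and g: "g \<in> L2_diamond M"
  shows "L2norm M (\<lambda>x. a * f x + b * g x) \<le> \<bar>a\<bar> * L2norm M f + \<bar>b\<bar> * L2norm M g"
proof (rule power2_le_imp_le)
  have "a * b * L2inner M f g \<le> \<bar>a * b * L2inner M f g\<bar>" by simp
  also have "\<dots> \<le> \<bar>a\<bar> * \<bar>b\<bar> * (L2norm M f * L2norm M g)"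
    unfolding abs_mult by (intro mult_left_mono L2inner_Cauchy_Schwarz f g) simp
  finally show "(L2norm M (\<lambda>x. a * f x + b * g x))\<^sup>2 \<le> (\<bar>a\<bar> * L2norm M f + \<bar>b\<bar> * L2norm M g)\<^sup>2"
    unfolding L2inner_self[symmetric] L2inner_self_lincomb[OF f g]
    by (simp add: power2_sum L2inner_self algebra_simps)
qed (simp add: L2norm_nonneg)


section \<open>Operators and their quadratic forms\<close>

text \<open>Stated for a single pair of functions, so that it serves both for bounds from
  \<open>norm_bound\<close> and for bounds from \<open>oper_norm\<close>.\<close>

lemma form_bound:
  assumes f: "f \<in> L2_diamond M" and g: "g \<in> L2_diamond M" and "L2norm M g \<le> C * L2norm M f"
  shows "\<bar>L2inner M g f\<bar> \<le> C * (L2norm M f)\<^sup>2"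
proof -
  have "\<bar>L2inner M g f\<bar> \<le> L2norm M g * L2norm M f"
    by (rule L2inner_Cauchy_Schwarz[OF g f])
  also have "\<dots> \<le> C * L2norm M f * L2norm M f"
    by (rule mult_right_mono[OF assms(3) L2norm_nonneg])
  finally show ?thesis by (simp add: power2_eq_square mult.assoc)
qed

lemma linear_operD:
  assumes "linear_oper M A" "f \<in> L2_diamond M"
  shows "A f \<in> L2_diamond M"
  using assms by (auto simp: linear_oper_def)

lemma linear_oper_AE:
  assumes "linear_oper M A" "f \<in> L2_diamond M" "g \<in> L2_diamond M"
  shows "AE x in M. A (\<lambda>y. a * f y + b * g y) x = a * A f x + b * A g x"
  using assms by (simp add: linear_oper_def)

lemma bounded_operD: "bounded_oper M A \<Longrightarrow> f \<in> L2_diamond M \<Longrightarrow> A f \<in> L2_diamond M"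
  by (auto simp: bounded_oper_def linear_operD)

lemma bounded_oper_lincomb:
  assumes A: "bounded_oper M A" and B: "bounded_oper M B"
  shows "bounded_oper M (\<lambda>f x. a * A f x + b * B f x)"
proof -
  obtain C D where C: "norm_bound M A C" and D: "norm_bound M B D"
    using A B by (auto simp: bounded_oper_def)
  have "norm_bound M (\<lambda>f x. a * A f x + b * B f x) (\<bar>a\<bar> * C + \<bar>b\<bar> * D)"
    unfolding norm_bound_def
  proof (intro conjI ballI)
    show "0 \<le> \<bar>a\<bar> * C + \<bar>b\<bar> * D" using C D by (simp add: norm_bound_def)
    fix f assume f: "f \<in> L2_diamond M"
    have "L2norm M (\<lambda>x. a * A f x + b * B f x) \<le> \<bar>a\<bar> * L2norm M (A f) + \<bar>b\<bar> * L2norm M (B f)"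
      by (intro L2norm_lincomb_le bounded_operD[OF A f] bounded_operD[OF B f])
    also have "\<dots> \<le> \<bar>a\<bar> * (C * L2norm M f) + \<bar>b\<bar> * (D * L2norm M f)"
      using C D f by (intro add_mono mult_left_mono) (auto simp: norm_bound_def)
    finally show "L2norm M (\<lambda>x. a * A f x + b * B f x) \<le> (\<bar>a\<bar> * C + \<bar>b\<bar> * D) * L2norm M f"
      by (simp add: algebra_simps)
  qed
  moreover have "linear_oper M (\<lambda>f x. a * A f x + b * B f x)"
    unfolding linear_oper_def
  proof (intro conjI ballI allI)
    show "(\<lambda>x. a * A f x + b * B f x) \<in> L2_diamond M" if f: "f \<in> L2_diamond M" for f
      by (rule L2_diamond_lincomb[OF bounded_operD[OF A f] bounded_operD[OF B f]])
    fix f g c d assume fg: "f \<in> L2_diamond M" "g \<in> L2_diamond M"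
    have "AE x in M. A (\<lambda>y. c * f y + d * g y) x = c * A f x + d * A g x"
      "AE x in M. B (\<lambda>y. c * f y + d * g y) x = c * B f x + d * B g x"
      using A B unfolding bounded_oper_def by (blast intro: linear_oper_AE[OF _ fg])+
    then show "AE x in M. a * A (\<lambda>y. c * f y + d * g y) x + b * B (\<lambda>y. c * f y + d * g y) x
        = c * (a * A f x + b * B f x) + d * (a * A g x + b * B g x)"
      by eventually_elim (simp add: algebra_simps)
  qed
  ultimately show ?thesis by (auto simp: bounded_oper_def)
qed

lemma self_adjoint_oper_lincomb:
  assumes "bounded_oper M A" "bounded_oper M B" "self_adjoint_oper M A" "self_adjoint_oper M B"
  shows "self_adjoint_oper M (\<lambda>f x. a * A f x + b * B f x)"
  using assms
  by (auto simp: self_adjoint_oper_def L2inner_lincomb_left L2inner_lincomb_right bounded_operD)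

lemma bounded_oper_id: "bounded_oper M (\<lambda>f. f)"
  unfolding bounded_oper_def linear_oper_def norm_bound_def
  by (auto intro: L2_diamond_lincomb exI[of _ 1])

lemma self_adjoint_oper_id: "self_adjoint_oper M (\<lambda>f. f)"
  by (simp add: self_adjoint_oper_def)

text \<open>For a nonlinear \<open>A\<close> the infimum runs over the empty set and is infinite, so
  a real upper bound already forces linearity. The infimum is approached by constants below
  \<open>C + e\<close>, and \<open>e\<close> is then sent to 0.\<close>

lemma oper_norm_bound:
  assumes "oper_norm M A \<le> ereal C" and f: "f \<in> L2_diamond M"
  shows "linear_oper M A" "L2norm M (A f) \<le> C * L2norm M f"
proof -
  let ?S = "{C. linear_oper M A \<and> norm_bound M A C}"
  have near: "\<exists>c\<in>?S. c < C + e" if "0 < e" for e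
  proof -
    have "(INF c\<in>?S. ereal c) < ereal (C + e)"
      using assms(1) that unfolding oper_norm_def by (rule_tac le_less_trans) auto
    then show ?thesis unfolding INF_less_iff by auto
  qed
  show "linear_oper M A" using near[of 1] by auto
  show "L2norm M (A f) \<le> C * L2norm M f"
  proof (rule field_le_epsilon)
    fix e :: real assume e: "0 < e"
    define n where "n = L2norm M f"
    have n: "0 \<le> n" by (simp add: n_def L2norm_nonneg)
    \<comment> \<open>Multiplied by \<open>n\<close>, the slack \<open>e / (n + 1)\<close> stays
      below \<open>e\<close>; the added 1 covers \<open>n = 0\<close>.\<close>
    obtain c where c: "norm_bound M A c" "c < C + e / (n + 1)"
      using near[of "e / (n + 1)"] e n by auto
    have "L2norm M (A f) \<le> c * n" using c(1) f by (simp add: norm_bound_def n_def)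
    also have "\<dots> \<le> (C + e / (n + 1)) * n" using c(2) n by (intro mult_right_mono) auto
    also have "\<dots> \<le> C * n + e" using e n by (simp add: field_simps)
    finally show "L2norm M (A f) \<le> C * L2norm M f + e" by (simp add: n_def)
  qed
qed

lemma oper_norm_form_bound:
  assumes "oper_norm M A \<le> ereal C" and f: "f \<in> L2_diamond M"
  shows "\<bar>L2inner M (A f) f\<bar> \<le> C * (L2norm M f)\<^sup>2"
  by (rule form_bound[OF f linear_operD[OF oper_norm_bound(1)[OF assms] f] oper_norm_bound(2)[OF assms]])

text \<open>Evaluate the form at $f - K^{-1} A f$.\<close>

lemma pos_semidef_norm_le_form:
  assumes A: "bounded_oper M A" "self_adjoint_oper M A" and pos: "pos_semidef_oper M A"
  obtains K where "0 < K" "\<And>f. f \<in> L2_diamond M \<Longrightarrow> (L2norm M (A f))\<^sup>2 \<le> K * L2inner M (A f) f"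
proof -
  obtain C where C: "norm_bound M A C" using A(1) by (auto simp: bounded_oper_def)
  \<comment> \<open>The bound \<open>C\<close> may be 0, while \<open>K\<close> is used as a
    divisor.\<close>
  define K where "K = C + 1"
  have K: "0 < K" using C by (simp add: K_def norm_bound_def)
  have "(L2norm M (A f))\<^sup>2 \<le> K * L2inner M (A f) f" if f: "f \<in> L2_diamond M" for f
  proof -
    define g where "g = A f"
    \<comment> \<open>This choice minimises \<open>- 2 * t + t\<^sup>2 * K\<close>, the factor of
      the squared norm of \<open>g\<close> in the final estimate; the minimum is
      \<open>- 1 / K\<close>.\<close>
    define t where "t = 1 / K"
    define u where "u = (\<lambda>x. 1 * f x + (- t) * g x)"
    have g: "g \<in> L2_diamond M" unfolding g_def by (rule bounded_operD[OF A(1) f])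
    have Ag: "A g \<in> L2_diamond M" by (rule bounded_operD[OF A(1) g])
    have u: "u \<in> L2_diamond M" unfolding u_def by (rule L2_diamond_lincomb[OF f g])
    have "\<bar>L2inner M (A g) g\<bar> \<le> C * (L2norm M g)\<^sup>2"
      using C g by (intro form_bound[OF g Ag]) (simp add: norm_bound_def)
    also have "\<dots> \<le> K * (L2norm M g)\<^sup>2"
      by (simp add: K_def algebra_simps)
    finally have qg: "L2inner M (A g) g \<le> K * (L2norm M g)\<^sup>2" by simp
    have "0 \<le> L2inner M (A u) u" using pos u by (simp add: pos_semidef_oper_def)
    \<comment> \<open>Linearity holds only almost everywhere, so \<open>A u\<close> is replaced
      inside the integral rather than as a function.\<close>
    also have "\<dots> = L2inner M (\<lambda>x. 1 * g x + (- t) * A g x) u"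
    proof (rule L2inner_cong_AE[OF bounded_operD[OF A(1) u] L2_diamond_lincomb[OF g Ag] u])
      have "linear_oper M A" using A(1) by (simp add: bounded_oper_def)
      then show "AE x in M. A u x = 1 * g x + (- t) * A g x"
        using linear_oper_AE[OF _ f g] unfolding u_def g_def by blast
    qed
    also have "\<dots> = L2inner M g f - t * L2inner M g g - t * L2inner M (A g) f
        + t\<^sup>2 * L2inner M (A g) g"
      unfolding L2inner_lincomb_left[OF g Ag u]
      by (simp add: u_def L2inner_lincomb_right[OF f g g, of 1 "-t", simplified]
          L2inner_lincomb_right[OF f g Ag, of 1 "-t", simplified] power2_eq_square algebra_simps)
    \<comment> \<open>Self-adjointness moves \<open>A\<close> onto \<open>f\<close>, and
      \<open>A f\<close> is \<open>g\<close>; both cross terms become equal.\<close>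
    also have "L2inner M (A g) f = L2inner M g g"
      using A(2) f g by (simp add: self_adjoint_oper_def g_def)
    also have "L2inner M g f - t * L2inner M g g - t * L2inner M g g + t\<^sup>2 * L2inner M (A g) g
        \<le> L2inner M g f - 2 * t * (L2norm M g)\<^sup>2 + t\<^sup>2 * (K * (L2norm M g)\<^sup>2)"
      using mult_left_mono[OF qg, of "t\<^sup>2"] by (simp add: L2inner_self)
    also have "\<dots> = L2inner M g f - (L2norm M g)\<^sup>2 / K"
      using K by (simp add: t_def power2_eq_square field_simps)
    finally show ?thesis using K by (simp add: g_def field_simps)
  qed
  with K show ?thesis using that by blast
qed

text \<open>
  The infimum \<open>m\<close> of the form on the unit sphere lies in the spectrum: for an inverse \<open>R\<close> of
  \<open>A - m\<close>, the previous lemma would bound $\|f\|^2 = \|R(A - m)f\|^2$ by a multiple of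
  $\langle (A - m) f, f\rangle$.
\<close>

lemma form_ge_spectrum_bound:
  assumes A: "bounded_oper M A" "self_adjoint_oper M A"
    and c: "\<And>s. s \<in> oper_spectrum M A \<Longrightarrow> c \<le> s" and f: "f \<in> L2_diamond M"
  shows "c * (L2norm M f)\<^sup>2 \<le> L2inner M (A f) f"
proof (cases "L2norm M f = 0")
  \<comment> \<open>Here \<open>f\<close> vanishes almost everywhere and has no Rayleigh quotient;
    both sides are 0.\<close>
  case True
  have "\<bar>L2inner M (A f) f\<bar> \<le> L2norm M (A f) * L2norm M f"
    by (rule L2inner_Cauchy_Schwarz[OF bounded_operD[OF A(1) f] f])
  with True show ?thesis by simp
next
  case False
  \<comment> \<open>The Rayleigh quotients of \<open>A\<close>; their infimum \<open>m\<close> is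
    finite because \<open>form\<close> bounds them below by \<open>- C\<close>.\<close>
  define Q where "Q = {L2inner M (A g) g / (L2norm M g)\<^sup>2 | g. g \<in> L2_diamond M \<and> L2norm M g \<noteq> 0}"
  define m where "m = Inf Q"
  obtain C where C: "norm_bound M A C" using A(1) by (auto simp: bounded_oper_def)
  have form: "\<bar>L2inner M (A g) g\<bar> \<le> C * (L2norm M g)\<^sup>2" if g: "g \<in> L2_diamond M" for g
    using C g by (intro form_bound[OF g bounded_operD[OF A(1) g]]) (simp add: norm_bound_def)
  have Q: "Q \<noteq> {}" using f False by (auto simp: Q_def)
  have "bdd_below Q"
  proof (rule bdd_belowI)
    fix q assume "q \<in> Q"
    then obtain g where g: "g \<in> L2_diamond M" "L2norm M g \<noteq> 0" "q = L2inner M (A g) g / (L2norm M g)\<^sup>2"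
      by (auto simp: Q_def)
    then have "0 < (L2norm M g)\<^sup>2" by simp
    then show "- C \<le> q" using form[OF g(1)] unfolding g(3) by (subst pos_le_divide_eq) auto
  qed
  then have low: "m * (L2norm M g)\<^sup>2 \<le> L2inner M (A g) g"
    if g: "g \<in> L2_diamond M" "L2norm M g \<noteq> 0" for g
  proof -
    have "m \<le> L2inner M (A g) g / (L2norm M g)\<^sup>2"
      unfolding m_def using g \<open>bdd_below Q\<close> by (intro cInf_lower) (auto simp: Q_def)
    then show ?thesis using g(2) by (simp add: pos_le_divide_eq)
  qed
  \<comment> \<open>Functions of norm zero are now included: there \<open>form\<close> makes the
    right-hand side vanish.\<close>
  have low: "m * (L2norm M g)\<^sup>2 \<le> L2inner M (A g) g" if g: "g \<in> L2_diamond M" for g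
    using low[OF g] form[OF g] by (cases "L2norm M g = 0") auto
  define B where "B = (\<lambda>f x. 1 * A f x + (- m) * f x)"
  have B: "bounded_oper M B" "self_adjoint_oper M B"
    unfolding B_def
    by (rule bounded_oper_lincomb[OF A(1) bounded_oper_id]
        self_adjoint_oper_lincomb[OF A(1) bounded_oper_id A(2) self_adjoint_oper_id])+
  have BD: "B g \<in> L2_diamond M" if "g \<in> L2_diamond M" for g using B(1) that by (rule bounded_operD)
  have Bform: "L2inner M (B g) g = L2inner M (A g) g - m * (L2norm M g)\<^sup>2" if g: "g \<in> L2_diamond M" for g
    unfolding B_def L2inner_lincomb_left[OF bounded_operD[OF A(1) g] g g] by (simp add: L2inner_self)
  have "pos_semidef_oper M B"
    unfolding pos_semidef_oper_def using low Bform by simp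
  then obtain K where K: "0 < K"
    "\<And>g. g \<in> L2_diamond M \<Longrightarrow> (L2norm M (B g))\<^sup>2 \<le> K * L2inner M (B g) g"
    using pos_semidef_norm_le_form[OF B] by metis
  have "m \<in> oper_spectrum M A"
  proof (rule ccontr)
    assume "m \<notin> oper_spectrum M A"
    then obtain R where R: "bounded_oper M R"
      and RB: "\<And>g. g \<in> L2_diamond M \<Longrightarrow> AE x in M. R (B g) x = g x"
      unfolding oper_spectrum_def B_def by auto
    obtain E where E: "norm_bound M R E" using R by (auto simp: bounded_oper_def)
    \<comment> \<open>An inverse of \<open>A - m\<close> would keep every Rayleigh quotient away
      from \<open>m\<close> by a fixed amount.\<close>
    have gap: "(L2norm M g)\<^sup>2 \<le> E\<^sup>2 * K * (L2inner M (A g) g - m * (L2norm M g)\<^sup>2)"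
      if g: "g \<in> L2_diamond M" for g
    proof -
      have "L2norm M g = L2norm M (R (B g))"
        using L2norm_cong_AE[OF bounded_operD[OF R BD[OF g]] g RB[OF g]] by simp
      also have "\<dots> \<le> E * L2norm M (B g)" using E BD[OF g] by (simp add: norm_bound_def)
      finally have "(L2norm M g)\<^sup>2 \<le> (E * L2norm M (B g))\<^sup>2"
        by (intro power_mono L2norm_nonneg)
      also have "\<dots> \<le> E\<^sup>2 * (K * L2inner M (B g) g)"
        unfolding power_mult_distrib by (intro mult_left_mono K(2) g) simp
      finally show ?thesis by (simp add: Bform[OF g])
    qed
    \<comment> \<open>Small enough that a quotient below \<open>m + e\<close> contradicts
      \<open>gap\<close>; such a quotient exists since \<open>m\<close> is the infimum of
      \<open>Q\<close>.\<close>
    define e where "e = 1 / (E\<^sup>2 * K + 1)"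
    have "0 \<le> E\<^sup>2 * K" using K(1) by simp
    then have e: "0 < e" "e * (E\<^sup>2 * K) < 1"
      unfolding e_def times_divide_eq_left mult_1 by (simp_all add: divide_less_eq_1)
    obtain q where "q \<in> Q" "q < m + e"
      using cInf_lessD[OF Q, of "m + e"] e(1) unfolding m_def by auto
    then obtain g where g: "g \<in> L2_diamond M" "L2norm M g \<noteq> 0"
      and "L2inner M (A g) g / (L2norm M g)\<^sup>2 < m + e"
      by (auto simp: Q_def)
    then have "L2inner M (A g) g - m * (L2norm M g)\<^sup>2 \<le> e * (L2norm M g)\<^sup>2"
      by (simp add: pos_divide_less_eq algebra_simps)
    then have "E\<^sup>2 * K * (L2inner M (A g) g - m * (L2norm M g)\<^sup>2) \<le> E\<^sup>2 * K * (e * (L2norm M g)\<^sup>2)"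
      using K(1) by (intro mult_left_mono) auto
    then have "(L2norm M g)\<^sup>2 \<le> (e * (E\<^sup>2 * K)) * (L2norm M g)\<^sup>2"
      using gap[OF g(1)] by (simp add: mult_ac)
    moreover have "0 < (L2norm M g)\<^sup>2" using g(2) by simp
    ultimately show False using e(2) by (simp add: mult_le_cancel_right1)
  qed
  then have "c * (L2norm M f)\<^sup>2 \<le> m * (L2norm M f)\<^sup>2" by (intro mult_right_mono c) auto
  also have "\<dots> \<le> L2inner M (A f) f" by (rule low[OF f])
  finally show ?thesis .
qed


section \<open>Conductivities\<close>

text \<open>Real numbers squeezed strictly between 0 and the essential infimum, and above the
  essential supremum, replace extended-real bounds by almost-everywhere inequalities. Closure under
  perturbation then becomes pointwise arithmetic.\<close>

lemma Linf_plus_iff: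
  "g \<in> Linf_plus \<Omega> \<longleftrightarrow> g \<in> borel_measurable (lebesgue_on \<Omega>) \<and>
     (\<exists>a b. 0 < a \<and> (AE x in lebesgue_on \<Omega>. a \<le> g x \<and> g x \<le> b))" (is "_ \<longleftrightarrow> ?m \<and> ?b")
proof (intro iffI conjI)
  assume g: "g \<in> Linf_plus \<Omega>"
  then show ?m by (simp add: Linf_plus_def)
  let ?S = "esssup (lebesgue_on \<Omega>) (\<lambda>x. ereal \<bar>g x\<bar>)"
  let ?I = "essinf (lebesgue_on \<Omega>) (\<lambda>x. ereal (g x))"
  from g have "?S < \<infinity>" "0 < ?I" by (auto simp: Linf_plus_def Linf_norm_def)
  then obtain a b where a: "0 < ereal a" "ereal a < ?I" and b: "?S < ereal b"
    by (metis ereal_dense2)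
  have "AE x in lebesgue_on \<Omega>. a \<le> g x \<and> g x \<le> b"
    using esssup_AE[of "\<lambda>x. ereal \<bar>g x\<bar>" "lebesgue_on \<Omega>"] esssup_AE[of "\<lambda>x. - ereal (g x)" "lebesgue_on \<Omega>"]
  proof eventually_elim
    case (elim x)
    have "ereal \<bar>g x\<bar> < ereal b" using elim(1) b by (rule le_less_trans)
    moreover have "ereal a < ereal (g x)"
      using elim(2) a(2) unfolding essinf_def by (metis ereal_minus_le_minus ereal_uminus_uminus less_le_trans)
    ultimately show ?case by auto
  qed
  with a(1) show ?b by auto
next
  assume *: "?m \<and> ?b"
  then obtain a b where ab: "0 < a" "AE x in lebesgue_on \<Omega>. a \<le> g x \<and> g x \<le> b" by auto
  from * have [measurable]: "g \<in> borel_measurable (lebesgue_on \<Omega>)" by simp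
  have "esssup (lebesgue_on \<Omega>) (\<lambda>x. ereal \<bar>g x\<bar>) \<le> ereal b"
    by (rule esssup_I) (measurable, use ab in auto)
  then have "Linf_norm \<Omega> g < \<infinity>" unfolding Linf_norm_def by (rule le_less_trans) simp
  have "esssup (lebesgue_on \<Omega>) (\<lambda>x. - ereal (g x)) \<le> ereal (- a)"
    by (rule esssup_I) (measurable, use ab in auto)
  then have "ereal a \<le> essinf (lebesgue_on \<Omega>) (\<lambda>x. ereal (g x))"
    unfolding essinf_def by (metis ereal_minus_le_minus ereal_uminus_uminus uminus_ereal.simps(1))
  then have "0 < essinf (lebesgue_on \<Omega>) (\<lambda>x. ereal (g x))"
    using ab(1) by (metis ereal_less(2) less_le_trans)
  then show "g \<in> Linf_plus \<Omega>"
    using \<open>Linf_norm \<Omega> g < \<infinity>\<close> by (simp add: Linf_plus_def)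
qed

lemma Linf_plus_const: "0 < c \<Longrightarrow> (\<lambda>x. c) \<in> Linf_plus \<Omega>"
  unfolding Linf_plus_iff by auto

lemma Linf_plus_add_indicator:
  assumes g: "g \<in> Linf_plus \<Omega>" and k: "k \<in> Linf_plus \<Omega>" and S: "open S"
  shows "(\<lambda>x. g x + k x * indicator S x) \<in> Linf_plus \<Omega>"
proof -
  have [measurable]: "g \<in> borel_measurable (lebesgue_on \<Omega>)" "k \<in> borel_measurable (lebesgue_on \<Omega>)"
    using g k by (auto simp: Linf_plus_iff)
  have [measurable]: "(indicator S :: _ \<Rightarrow> real) \<in> borel_measurable (lebesgue_on \<Omega>)"
    using S by (intro measurable_restrict_space1 measurable_completion borel_measurable_indicator) auto
  obtain a b where ab: "0 < a" "AE x in lebesgue_on \<Omega>. a \<le> g x \<and> g x \<le> b"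
    using g unfolding Linf_plus_iff by auto
  obtain c d where cd: "0 < c" "AE x in lebesgue_on \<Omega>. c \<le> k x \<and> k x \<le> d"
    using k unfolding Linf_plus_iff by auto
  have "AE x in lebesgue_on \<Omega>. a \<le> g x + k x * indicator S x \<and> g x + k x * indicator S x \<le> b + d"
    using ab(2) cd(2)
  proof eventually_elim
    case (elim x)
    \<comment> \<open>Off \<open>S\<close> the upper bound still holds because
      \<open>0 < c \<le> k x \<le> d\<close> makes \<open>d\<close> positive.\<close>
    then show ?case using cd(1) by (cases "x \<in> S") auto
  qed
  with ab(1) show ?thesis unfolding Linf_plus_iff by (intro conjI exI) (measurable, auto)
qed

text \<open>Makes the model error bound a product of reals, so that it can be added to other errors
  and passed to the limit.\<close>

lemma Linf_norm_real:
  assumes g: "g \<in> Linf_plus \<Omega>" and \<Omega>: "open \<Omega>" "\<Omega> \<noteq> {}"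
  obtains c where "Linf_norm \<Omega> g = ereal c"
proof -
  have "Linf_norm \<Omega> g < \<infinity>" using g by (simp add: Linf_plus_def)
  moreover have "0 \<le> Linf_norm \<Omega> g"
  proof -
    \<comment> \<open>On a null set the essential supremum of 0 would be minus infinity; a nonempty
      open set is not null.\<close>
    have "emeasure (lebesgue_on \<Omega>) (space (lebesgue_on \<Omega>)) \<noteq> 0"
    proof
      assume "emeasure (lebesgue_on \<Omega>) (space (lebesgue_on \<Omega>)) = 0"
      then have "\<Omega> \<in> null_sets lebesgue"
        using \<Omega>(1) by (simp add: emeasure_restrict_space null_sets_def)
      then show False
        using open_not_negligible[OF \<Omega>] by (simp add: negligible_iff_null_sets)
    qed
    then have "esssup (lebesgue_on \<Omega>) (\<lambda>x. 0 :: ereal) = 0" by (rule esssup_const)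
    moreover have "esssup (lebesgue_on \<Omega>) (\<lambda>x. 0 :: ereal) \<le> Linf_norm \<Omega> g"
      unfolding Linf_norm_def by (rule esssup_mono) auto
    ultimately show ?thesis by simp
  qed
  ultimately show ?thesis using that by (cases "Linf_norm \<Omega> g") auto
qed

section \<open>Ball tests under perturbation\<close>

lemma ball_testsD:
  assumes "B \<in> ball_tests \<Omega> \<alpha> S"
  shows "B \<subseteq> \<Omega>" "\<exists>c r. 0 < r \<and> B = ball c r" "open B"
    "pos_semidef_oper (surface_measure \<Omega>) (\<lambda>f x. S B f x + \<alpha> * f x)"
  using assms by (auto simp: ball_tests_def)

lemma ball_testsI:
  assumes "B \<in> ball_tests \<Omega> \<alpha> S" "pos_semidef_oper (surface_measure \<Omega>) (\<lambda>f x. S' B f x + \<alpha>' * f x)"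
  shows "B \<in> ball_tests \<Omega> \<alpha>' S'"
  using assms by (auto simp: ball_tests_def)

text \<open>The cycle \<open>L\<close>, full intersection, lower limit, upper limit, back to
  \<open>L\<close> consists of inclusions, so all four sets coincide.\<close>

lemma has_set_limitI:
  assumes "\<And>h \<delta>. 0 < h \<Longrightarrow> 0 < \<delta> \<Longrightarrow> L \<subseteq> A h \<delta>" and limsup: "set_limsup A \<subseteq> L"
  shows "has_set_limit A L \<and> L = (\<Inter>h\<in>{0<..}. \<Inter>\<delta>\<in>{0<..}. A h \<delta>)"
proof -
  have le_Inter: "L \<subseteq> (\<Inter>h\<in>{0<..}. \<Inter>\<delta>\<in>{0<..}. A h \<delta>)"
    using assms(1) by blast
  have Inter_le: "(\<Inter>h\<in>{0<..}. \<Inter>\<delta>\<in>{0<..}. A h \<delta>) \<subseteq> set_liminf A"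
  proof
    fix x assume "x \<in> (\<Inter>h\<in>{0<..}. \<Inter>\<delta>\<in>{0<..}. A h \<delta>)"
    then show "x \<in> set_liminf A"
      unfolding set_liminf_def by (intro UN_I[of 1]) auto
  qed
  have liminf_le: "set_liminf A \<subseteq> set_limsup A"
  proof
    fix x assume "x \<in> set_liminf A"
    then obtain e where e: "0 < e" "\<And>h \<delta>. h \<in> {0<..e} \<Longrightarrow> \<delta> \<in> {0<..e} \<Longrightarrow> x \<in> A h \<delta>"
      unfolding set_liminf_def by auto
    have "x \<in> (\<Union>h\<in>{0<..d}. \<Union>\<delta>\<in>{0<..d}. A h \<delta>)" if "0 < d" for d
      \<comment> \<open>The same value serves for \<open>h\<close> and for \<delta>: it lies in both
        parameter ranges.\<close>
      using e that by (intro UN_I[of "min d e"]) auto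
    then show "x \<in> set_limsup A" unfolding set_limsup_def by simp
  qed
  show ?thesis unfolding has_set_limit_def
  proof (intro conjI)
    show "set_liminf A = L"
      by (rule antisym[OF order_trans[OF liminf_le limsup] order_trans[OF le_Inter Inter_le]])
    show "set_limsup A = L"
      by (rule antisym[OF limsup order_trans[OF le_Inter order_trans[OF Inter_le liminf_le]]])
    show "L = (\<Inter>h\<in>{0<..}. \<Inter>\<delta>\<in>{0<..}. A h \<delta>)"
      by (rule antisym[OF le_Inter order_trans[OF Inter_le order_trans[OF liminf_le limsup]]])
  qed
qed

text \<open>Membership in the upper limit occurs frequently along the product filter, so it can be
  combined with any eventual property at one common pair of parameters.\<close>

lemma set_limsup_frequently:
  assumes "x \<in> set_limsup A" and ev: "eventually P (at_right 0 \<times>\<^sub>F at_right 0)"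
  obtains h \<delta> where "0 < h" "0 < \<delta>" "P (h, \<delta>)" "x \<in> A h \<delta>"
proof -
  obtain Q R where "eventually Q (at_right 0)" "eventually R (at_right 0)"
    and QR: "\<And>h \<delta>. Q h \<Longrightarrow> R \<delta> \<Longrightarrow> P (h, \<delta>)"
    using ev unfolding eventually_prod_filter by auto
  then obtain a b where ab: "0 < a" "\<forall>h>0. h < a \<longrightarrow> Q h" "0 < b" "\<forall>\<delta>>0. \<delta> < b \<longrightarrow> R \<delta>"
    unfolding eventually_at_right_field by blast
  \<comment> \<open>Halving is needed because the intervals in \<open>set_limsup\<close> contain
    their right endpoint, whereas the eventual properties hold only strictly below \<open>a\<close>
    and \<open>b\<close>.\<close>
  have "min a b / 2 \<in> {0<..}" using ab by auto
  with assms(1) have "x \<in> (\<Union>h\<in>{0<..min a b / 2}. \<Union>\<delta>\<in>{0<..min a b / 2}. A h \<delta>)"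
    unfolding set_limsup_def by blast
  then obtain h \<delta> where h: "0 < h" "h \<le> min a b / 2" "0 < \<delta>" "\<delta> \<le> min a b / 2" "x \<in> A h \<delta>"
    by auto
  moreover have "P (h, \<delta>)" using h ab by (intro QR) auto
  ultimately show ?thesis using that by blast
qed

section \<open>Convergence of the regularised ball tests\<close>

theorem corollary1:
  fixes \<Omega> D :: "(real^'n) set"
    and \<gamma>0 \<kappa> \<gamma> :: "real^'n \<Rightarrow> real"
    and \<beta> :: real
    and \<Lambda>h :: "real \<Rightarrow> (real^'n \<Rightarrow> real) \<Rightarrow> (real^'n) oper"
    and \<omega> :: "real \<Rightarrow> real"
    and N :: "real \<Rightarrow> (real^'n) oper"
    and T :: "(real^'n) set \<Rightarrow> (real^'n) oper"
    and Th :: "real \<Rightarrow> (real^'n) set \<Rightarrow> (real^'n) oper"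
    and Thd :: "real \<Rightarrow> real \<Rightarrow> (real^'n) set \<Rightarrow> (real^'n) oper"
    and \<alpha> :: "real \<Rightarrow> real \<Rightarrow> real"
  assumes dimension: "CARD('n) = 2 \<or> CARD('n) = 3"
    and domain: "lipschitz_domain \<Omega>"
    \<comment> \<open>the approximate models\<close>
    and models_compact: "\<And>h g. 0 < h \<Longrightarrow> g \<in> Linf_plus \<Omega> \<Longrightarrow>
      compact_oper (surface_measure \<Omega>) (\<Lambda>h h g) \<and> self_adjoint_oper (surface_measure \<Omega>) (\<Lambda>h h g)"
    and models_well_defined: "\<And>h g g' f. 0 < h \<Longrightarrow> g \<in> Linf_plus \<Omega> \<Longrightarrow> g' \<in> Linf_plus \<Omega> \<Longrightarrow>
      (AE x in lebesgue_on \<Omega>. g x = g' x) \<Longrightarrow> f \<in> L2_diamond (surface_measure \<Omega>) \<Longrightarrow>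
      (AE x in surface_measure \<Omega>. \<Lambda>h h g f x = \<Lambda>h h g' f x)"
    and models_error: "\<And>h g. 0 < h \<Longrightarrow> g \<in> Linf_plus \<Omega> \<Longrightarrow>
      oper_norm (surface_measure \<Omega>) (\<lambda>f x. ND_map \<Omega> g f x - \<Lambda>h h g f x)
        \<le> ereal (\<omega> h) * Linf_norm \<Omega> g"
    and models_limit: "(\<omega> \<longlongrightarrow> 0) (at_right 0)"
    \<comment> \<open>the noise\<close>
    and noise_compact: "\<And>\<delta>. 0 < \<delta> \<Longrightarrow>
      compact_oper (surface_measure \<Omega>) (N \<delta>) \<and> self_adjoint_oper (surface_measure \<Omega>) (N \<delta>)"
    and noise_bound: "\<And>\<delta>. 0 < \<delta> \<Longrightarrow> oper_norm (surface_measure \<Omega>) (N \<delta>) \<le> ereal \<delta>"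
    \<comment> \<open>the conductivity and the test operators\<close>
    and background: "\<gamma>0 \<in> Linf_plus \<Omega>" "Cinf_closure \<Omega> \<gamma>0"
    and perturbation: "\<kappa> \<in> Linf_plus \<Omega>" "open D" "closure D \<subseteq> \<Omega>"
    and conductivity: "\<gamma> = (\<lambda>x. \<gamma>0 x + \<kappa> x * indicator D x)"
    and beta: "0 < \<beta>"
    and T: "T = (\<lambda>B f x. ND_map \<Omega> (test_conductivity \<gamma>0 \<beta> B) f x - ND_map \<Omega> \<gamma> f x)"
    and Th: "Th = (\<lambda>h B f x. \<Lambda>h h (test_conductivity \<gamma>0 \<beta> B) f x - \<Lambda>h h \<gamma> f x)"
    and Thd: "Thd = (\<lambda>h \<delta> B f x.
      \<Lambda>h h (test_conductivity \<gamma>0 \<beta> B) f x - (\<Lambda>h h \<gamma> f x + N \<delta> f x))"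
    \<comment> \<open>the regularization parameter\<close>
    and alpha_bound: "\<And>h \<delta>. 0 < h \<Longrightarrow> 0 < \<delta> \<Longrightarrow>
      ereal (\<delta> - \<alpha> h \<delta>) \<le>
        (INF B\<in>ball_tests \<Omega> 0 T. INF s\<in>oper_spectrum (surface_measure \<Omega>) (Th h B). ereal s)"
    and alpha_limit: "((\<lambda>(h, \<delta>). \<alpha> h \<delta>) \<longlongrightarrow> 0) (at_right 0 \<times>\<^sub>F at_right 0)"
  shows "has_set_limit (\<lambda>h \<delta>. ball_tests \<Omega> (\<alpha> h \<delta>) (Thd h \<delta>)) (ball_tests \<Omega> 0 T)
    \<and> ball_tests \<Omega> 0 T = (\<Inter>h\<in>{0<..}. \<Inter>\<delta>\<in>{0<..}. ball_tests \<Omega> (\<alpha> h \<delta>) (Thd h \<delta>))"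
proof (rule has_set_limitI)
  let ?M = "surface_measure \<Omega>"
  let ?E = "\<lambda>h g f x. ND_map \<Omega> g f x - \<Lambda>h h g f x"
  let ?\<gamma> = "test_conductivity \<gamma>0 \<beta>"
  have \<gamma>: "\<gamma> \<in> Linf_plus \<Omega>"
    unfolding conductivity by (rule Linf_plus_add_indicator[OF background(1) perturbation(1,2)])
  have \<gamma>B: "?\<gamma> B \<in> Linf_plus \<Omega>" if "open B" for B
    unfolding test_conductivity_def
    by (rule Linf_plus_add_indicator[OF background(1) Linf_plus_const[OF beta] that])
  have model: "bounded_oper ?M (\<Lambda>h h g)" "self_adjoint_oper ?M (\<Lambda>h h g)"
    if "0 < h" "g \<in> Linf_plus \<Omega>" for h g
    using models_compact[OF that] by (auto simp: compact_oper_def)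
  have noise: "bounded_oper ?M (N \<delta>)" if "0 < \<delta>" for \<delta>
    using noise_compact[OF that] by (auto simp: compact_oper_def)
  have Th_bounded: "bounded_oper ?M (Th h B)" and Th_self_adjoint: "self_adjoint_oper ?M (Th h B)"
    if "0 < h" "open B" for h B
    using bounded_oper_lincomb[OF model(1)[OF that(1) \<gamma>B[OF that(2)]] model(1)[OF that(1) \<gamma>], of 1 "-1"]
      self_adjoint_oper_lincomb[OF model(1)[OF that(1) \<gamma>B[OF that(2)]] model(1)[OF that(1) \<gamma>]
        model(2)[OF that(1) \<gamma>B[OF that(2)]] model(2)[OF that(1) \<gamma>], of 1 "-1"]
    by (simp_all add: Th)
  have Thd_Th: "Thd h \<delta> B f = (\<lambda>x. Th h B f x - N \<delta> f x)" for h \<delta> B f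
    by (simp add: Thd Th algebra_simps)
  have Thd_form: "L2inner ?M (\<lambda>x. Thd h \<delta> B f x + a * f x) f
      = L2inner ?M (Th h B f) f - L2inner ?M (N \<delta> f) f + a * (L2norm ?M f)\<^sup>2"
    if "0 < h" "0 < \<delta>" "open B" "f \<in> L2_diamond ?M" for h \<delta> B f a
  proof -
    have d: "Th h B f \<in> L2_diamond ?M" "N \<delta> f \<in> L2_diamond ?M"
      using bounded_operD[OF Th_bounded] bounded_operD[OF noise] that by blast+
    then have D: "Thd h \<delta> B f \<in> L2_diamond ?M"
      unfolding Thd_Th by (rule L2_diamond_diff)
    show "L2inner ?M (\<lambda>x. Thd h \<delta> B f x + a * f x) f
      = L2inner ?M (Th h B f) f - L2inner ?M (N \<delta> f) f + a * (L2norm ?M f)\<^sup>2"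
      using L2inner_lincomb_left[OF D that(4) that(4), of 1 a]
      by (simp add: Thd_Th L2inner_diff_left[OF d that(4)] L2inner_self)
  qed
  show "ball_tests \<Omega> 0 T \<subseteq> ball_tests \<Omega> (\<alpha> h \<delta>) (Thd h \<delta>)" if h: "0 < h" "0 < \<delta>" for h \<delta>
  proof
    fix B assume B: "B \<in> ball_tests \<Omega> 0 T"
    show "B \<in> ball_tests \<Omega> (\<alpha> h \<delta>) (Thd h \<delta>)"
    proof (rule ball_testsI[OF B], unfold pos_semidef_oper_def, intro ballI)
      fix f assume f: "f \<in> L2_diamond ?M"
      \<comment> \<open>The double infimum in the parameter choice is specialised first to the ball
        \<open>B\<close> and then to a spectral value of \<open>Th h B\<close>.\<close>
      have "\<delta> - \<alpha> h \<delta> \<le> s" if s: "s \<in> oper_spectrum ?M (Th h B)" for s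
      proof -
        have "ereal (\<delta> - \<alpha> h \<delta>) \<le> (INF s\<in>oper_spectrum ?M (Th h B). ereal s)"
          using alpha_bound[OF h] INF_lower[OF B] by (rule order_trans)
        also have "\<dots> \<le> ereal s" using s by (rule INF_lower)
        finally show ?thesis by simp
      qed
      then have "(\<delta> - \<alpha> h \<delta>) * (L2norm ?M f)\<^sup>2 \<le> L2inner ?M (Th h B f) f"
        using form_ge_spectrum_bound[OF Th_bounded[OF h(1) ball_testsD(3)[OF B]]
            Th_self_adjoint[OF h(1) ball_testsD(3)[OF B]] _ f] by blast
      \<comment> \<open>The form of \<open>Th h B\<close> contributes \<delta> - \<alpha>, the noise
        at worst -\<delta> and the regularisation \<alpha>; these cancel exactly.\<close>
      moreover have "\<bar>L2inner ?M (N \<delta> f) f\<bar> \<le> \<delta> * (L2norm ?M f)\<^sup>2"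
        by (rule oper_norm_form_bound[OF noise_bound[OF h(2)] f])
      ultimately show "0 \<le> L2inner ?M (\<lambda>x. Thd h \<delta> B f x + \<alpha> h \<delta> * f x) f"
        unfolding Thd_form[OF h ball_testsD(3)[OF B] f] by (simp add: algebra_simps)
    qed
  qed
  show "set_limsup (\<lambda>h \<delta>. ball_tests \<Omega> (\<alpha> h \<delta>) (Thd h \<delta>)) \<subseteq> ball_tests \<Omega> 0 T"
  proof
    fix B assume B: "B \<in> set_limsup (\<lambda>h \<delta>. ball_tests \<Omega> (\<alpha> h \<delta>) (Thd h \<delta>))"
    \<comment> \<open>One arbitrary pair suffices to learn that \<open>B\<close> is a ball inside
      \<Omega>. The norms \<open>c\<close> and \<open>d\<close> are then fixed before the parameters
      tend to 0.\<close>
    obtain h0 \<delta>0 where B0: "B \<in> ball_tests \<Omega> (\<alpha> h0 \<delta>0) (Thd h0 \<delta>0)"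
      by (rule set_limsup_frequently[OF B eventually_True])
    note oB = ball_testsD(3)[OF B0]
    have \<Omega>: "open \<Omega>" "\<Omega> \<noteq> {}" using domain by (auto simp: lipschitz_domain_def)
    obtain c where c: "Linf_norm \<Omega> (?\<gamma> B) = ereal c"
      by (rule Linf_norm_real[OF \<gamma>B[OF oB] \<Omega>])
    obtain d where d: "Linf_norm \<Omega> \<gamma> = ereal d"
      by (rule Linf_norm_real[OF \<gamma> \<Omega>])
    show "B \<in> ball_tests \<Omega> 0 T"
    proof (rule ball_testsI[OF B0], unfold pos_semidef_oper_def, intro ballI)
      fix f assume f: "f \<in> L2_diamond ?M"
      let ?n = "(L2norm ?M f)\<^sup>2"
      \<comment> \<open>Total error at \<open>f\<close>: regularisation, noise, and the model errors
        for the test conductivity and for \<gamma>.\<close>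
      let ?r = "\<lambda>(h, \<delta>). (\<alpha> h \<delta> + \<delta> + \<omega> h * c + \<omega> h * d) * ?n"
      have low: "- ?r (h, \<delta>) \<le> L2inner ?M (T B f) f"
        if h: "0 < h" "0 < \<delta>" and Bh: "B \<in> ball_tests \<Omega> (\<alpha> h \<delta>) (Thd h \<delta>)" for h \<delta>
      proof -
        have e1: "oper_norm ?M (?E h (?\<gamma> B)) \<le> ereal (\<omega> h * c)"
          using models_error[OF h(1) \<gamma>B[OF oB]] c by simp
        have e2: "oper_norm ?M (?E h \<gamma>) \<le> ereal (\<omega> h * d)"
          using models_error[OF h(1) \<gamma>] d by simp
        have E: "?E h (?\<gamma> B) f \<in> L2_diamond ?M" "?E h \<gamma> f \<in> L2_diamond ?M"
          using linear_operD[OF oper_norm_bound(1)[OF e1 f] f]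
            linear_operD[OF oper_norm_bound(1)[OF e2 f] f] by simp_all
        have D: "Th h B f \<in> L2_diamond ?M"
          by (rule bounded_operD[OF Th_bounded[OF h(1) oB] f])
        \<comment> \<open>The exact maps enter only through their differences from the models, which
          \<open>E\<close> places in \<open>L2_diamond\<close>; this permits splitting the
          integral.\<close>
        have "T B f = (\<lambda>x. 1 * Th h B f x + 1 * (?E h (?\<gamma> B) f x - ?E h \<gamma> f x))"
          by (simp add: T Th)
        then have "L2inner ?M (T B f) f
            = L2inner ?M (Th h B f) f + (L2inner ?M (?E h (?\<gamma> B) f) f - L2inner ?M (?E h \<gamma> f) f)"
          using L2inner_lincomb_left[OF D L2_diamond_diff[OF E] f, of 1 1]
          by (simp only: L2inner_diff_left[OF E f] mult_1)
        moreover have "0 \<le> L2inner ?M (Th h B f) f - L2inner ?M (N \<delta> f) f + \<alpha> h \<delta> * ?n"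
          using ball_testsD(4)[OF Bh] f unfolding pos_semidef_oper_def Thd_form[OF h oB f, symmetric]
          by blast
        ultimately show ?thesis
          using oper_norm_form_bound[OF e1 f] oper_norm_form_bound[OF e2 f]
            oper_norm_form_bound[OF noise_bound[OF h(2)] f]
          by (simp add: algebra_simps)
      qed
      have "(?r \<longlongrightarrow> (0 + 0 + 0 * c + 0 * d) * ?n) (at_right 0 \<times>\<^sub>F at_right 0)"
      proof -
        have "((\<lambda>p. \<omega> (fst p)) \<longlongrightarrow> 0) (at_right 0 \<times>\<^sub>F at_right (0::real))"
          by (rule filterlim_compose[OF models_limit filterlim_fst])
        moreover have "(snd \<longlongrightarrow> 0) (at_right (0::real) \<times>\<^sub>F at_right (0::real))"
          by (rule filterlim_mono[OF filterlim_snd at_within_le_nhds order_refl])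
        ultimately show ?thesis
          using alpha_limit unfolding case_prod_unfold
          by (intro tendsto_mult tendsto_add tendsto_const)
      qed
      then have lim: "(?r \<longlongrightarrow> 0) (at_right 0 \<times>\<^sub>F at_right 0)" by simp
      have "0 \<le> L2inner ?M (T B f) f"
      proof (rule ccontr)
        \<comment> \<open>A negative form would eventually lie below \<open>- ?r\<close>, while
          \<open>B\<close> still passes the test at some such pair, contradicting
          \<open>low\<close>.\<close>
        assume neg: "\<not> ?thesis"
        then have "\<forall>\<^sub>F p in at_right 0 \<times>\<^sub>F at_right 0. ?r p < - L2inner ?M (T B f) f"
          by (intro order_tendstoD(2)[OF lim]) simp
        then obtain h \<delta> where h: "0 < h" "0 < \<delta>" "B \<in> ball_tests \<Omega> (\<alpha> h \<delta>) (Thd h \<delta>)"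
          and small: "?r (h, \<delta>) < - L2inner ?M (T B f) f"
          by (rule set_limsup_frequently[OF B])
        show False using low[OF h] small by linarith
      qed
      then show "0 \<le> L2inner ?M (\<lambda>x. T B f x + 0 * f x) f" by simp
    qed
  qed
qed

end
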